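(* Let $K$ be a field, let $G$ be a simple graph on the vertex set $[n]=\{1,\dots,n\}$ with no isolated vertices, and let $I=I(G)$ be the edge ideal of $G$ in $S=K[x_1,x_2,\ldots,x_n]$. Let $\mathfrak m=(x_1,\ldots,x_n)$. The following conditions are equivalent: (a) $I^2$ is of intersection type; (b) $\operatorname{Ass}(S/I^2)\subset\operatorname{Ass}(S/I)\cup\{\mathfrak m\}$; (c) all $3$-cycles of the graph $G$ are central.
   Context: A simple graph is a finite graph without loops and multiple edges. The edge ideal $I(G)\subset K[x_1,\ldots,x_n]$ is generated by the monomials $x_ix_j$ with $\{i,j\}$ an edge of $G$. A $3$-cycle $C$ of $G$ is called central if all vertices of $G$ are neighbors of $C$, i.e. every vertex of $G$ is adjacent to some vertex of $C$ (the vertices of $C$ satisfy this automatically). A monomial prime ideal is a prime ideal generated by a subset of the variables. A monomial ideal is of intersection type if it is an intersection of powers (with positive integer exponents) of monomial prime ideals. *)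

theory Defs
  imports
    "HOL-Library.Poly_Mapping"
    "HOL-Algebra.QuotRing"
    "HOL-Algebra.Ideal_Product"
begin

text \<open>
  Exponent vectors are finitely supported maps from variable indices to \<open>nat\<close>, and
  a polynomial is a finitely supported map from exponent vectors to coefficients.
  \<open>poly_ring V\<close> is \<open>K[x\<^sub>v | v \<in> V]\<close>: it consists of the polynomials
  in whose monomials only variables indexed by \<open>V\<close> occur.
\<close>

definition poly_ring :: "'v set \<Rightarrow> (('v \<Rightarrow>\<^sub>0 nat) \<Rightarrow>\<^sub>0 'k::field) ring" where
  "poly_ring V =
     \<lparr>carrier = {p. \<forall>m\<in>Poly_Mapping.keys p. Poly_Mapping.keys m \<subseteq> V},
      mult = (*), one = 1, zero = 0, add = (+)\<rparr>"

definition Var :: "'v \<Rightarrow> (('v \<Rightarrow>\<^sub>0 nat) \<Rightarrow>\<^sub>0 'k::field)" where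
  "Var v = Poly_Mapping.single (Poly_Mapping.single v 1) 1"

lemma Var_in_poly_ring: "v \<in> V \<Longrightarrow> Var v \<in> carrier (poly_ring V)"
  by (simp add: Var_def poly_ring_def)

lemma poly_ring_cring: "cring (poly_ring V :: (('v \<Rightarrow>\<^sub>0 nat) \<Rightarrow>\<^sub>0 'k::field) ring)"
proof -
  let ?R = "poly_ring V :: (('v \<Rightarrow>\<^sub>0 nat) \<Rightarrow>\<^sub>0 'k) ring"
  have add: "p + q \<in> carrier ?R" if "p \<in> carrier ?R" "q \<in> carrier ?R" for p q
    using that Poly_Mapping.keys_add[of p q] unfolding poly_ring_def by auto
  have mult: "p * q \<in> carrier ?R" if p: "p \<in> carrier ?R" and q: "q \<in> carrier ?R" for p q
  proof -
    have "Poly_Mapping.keys m \<subseteq> V" if "m \<in> Poly_Mapping.keys (p * q)" for m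
    proof -
      obtain a b where ab: "m = a + b" "a \<in> Poly_Mapping.keys p" "b \<in> Poly_Mapping.keys q"
        using \<open>m \<in> _\<close> Poly_Mapping.keys_mult[of p q] by blast
      then have "Poly_Mapping.keys a \<subseteq> V" "Poly_Mapping.keys b \<subseteq> V"
        using p q by (auto simp: poly_ring_def)
      then show ?thesis
        using Poly_Mapping.keys_add[of a b] ab(1) by blast
    qed
    then show ?thesis by (simp add: poly_ring_def)
  qed
  show ?thesis
  proof (rule cringI)
    show "abelian_group ?R"
    proof (rule abelian_groupI)
      fix p assume "p \<in> carrier ?R"
      then show "\<exists>q\<in>carrier ?R. q \<oplus>\<^bsub>?R\<^esub> p = \<zero>\<^bsub>?R\<^esub>"
        by (intro bexI[of _ "- p"]) (auto simp: poly_ring_def)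
    next
      fix p q assume "p \<in> carrier ?R" "q \<in> carrier ?R"
      then show "p \<oplus>\<^bsub>?R\<^esub> q \<in> carrier ?R"
        using add[of p q] by (simp only: poly_ring_def monoid.simps ring.simps partial_object.simps)
    qed (simp_all add: poly_ring_def add_ac)
    show "Group.comm_monoid ?R"
    proof (rule comm_monoidI)
      fix p q assume "p \<in> carrier ?R" "q \<in> carrier ?R"
      then show "p \<otimes>\<^bsub>?R\<^esub> q \<in> carrier ?R"
        using mult[of p q] by (simp only: poly_ring_def monoid.simps ring.simps partial_object.simps)
    qed (simp_all add: poly_ring_def mult_ac)
  qed (simp add: poly_ring_def distrib_right)
qed


abbreviation ideal_power :: "('a, 'b) ring_scheme \<Rightarrow> 'a set \<Rightarrow> nat \<Rightarrow> 'a set" where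
  "ideal_power R I k \<equiv> I [^]\<^bsub>ideals_set R\<^esub> k"

text \<open>
  \<open>Ass_quot R I\<close> is the set of associated primes of the \<open>R\<close>-module \<open>R/I\<close>, i.e.
  the prime ideals of \<open>R\<close> that are the annihilator of some \<open>x \<in> R/I\<close>;
  \<open>r \<in> R\<close> acts on \<open>R/I\<close> as multiplication by the residue class \<open>I + r\<close>.
\<close>

definition Ass_quot :: "('a, 'b) ring_scheme \<Rightarrow> 'a set \<Rightarrow> 'a set set" where
  "Ass_quot R I =
     {P. primeideal P R \<and>
         (\<exists>x\<in>carrier (R Quot I).
            P = {r \<in> carrier R. (I +>\<^bsub>R\<^esub> r) \<otimes>\<^bsub>R Quot I\<^esub> x = \<zero>\<^bsub>R Quot I\<^esub>})}"


definition monomial_prime :: "'v set \<Rightarrow> (('v \<Rightarrow>\<^sub>0 nat) \<Rightarrow>\<^sub>0 'k::field) set \<Rightarrow> bool" where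
  "monomial_prime V P \<longleftrightarrow>
     primeideal P (poly_ring V) \<and> (\<exists>A\<subseteq>V. P = Idl\<^bsub>poly_ring V\<^esub> (Var ` A))"

text \<open>
  The notion is meant for monomial ideals \<open>J\<close>; this is not repeated in the definition because
  intersections of powers of monomial primes are always monomial.
\<close>

definition intersection_type :: "'v set \<Rightarrow> (('v \<Rightarrow>\<^sub>0 nat) \<Rightarrow>\<^sub>0 'k::field) set \<Rightarrow> bool" where
  "intersection_type V J \<longleftrightarrow>
     (\<exists>F. finite F \<and> F \<noteq> {} \<and> (\<forall>(P, k)\<in>F. monomial_prime V P \<and> 0 < k) \<and>
          J = (\<Inter>(P, k)\<in>F. ideal_power (poly_ring V) P k))"


definition simple_graph :: "'v set \<Rightarrow> 'v set set \<Rightarrow> bool" where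
  "simple_graph V E \<longleftrightarrow> finite V \<and> (\<forall>e\<in>E. e \<subseteq> V \<and> card e = 2)"

definition no_isolated_vertices :: "'v set \<Rightarrow> 'v set set \<Rightarrow> bool" where
  "no_isolated_vertices V E \<longleftrightarrow> (\<forall>v\<in>V. \<exists>w\<in>V. {v, w} \<in> E)"

definition three_cycle :: "'v set set \<Rightarrow> 'v set \<Rightarrow> bool" where
  "three_cycle E C \<longleftrightarrow>
     (\<exists>a b c. C = {a, b, c} \<and> a \<noteq> b \<and> b \<noteq> c \<and> a \<noteq> c \<and>
              {a, b} \<in> E \<and> {b, c} \<in> E \<and> {a, c} \<in> E)"

definition central :: "'v set \<Rightarrow> 'v set set \<Rightarrow> 'v set \<Rightarrow> bool" where
  "central V E C \<longleftrightarrow> (\<forall>v\<in>V. \<exists>c\<in>C. {v, c} \<in> E)"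

definition edge_ideal :: "'v set \<Rightarrow> 'v set set \<Rightarrow> (('v \<Rightarrow>\<^sub>0 nat) \<Rightarrow>\<^sub>0 'k::field) set" where
  "edge_ideal V E = Idl\<^bsub>poly_ring V\<^esub> {Var i * Var j | i j. {i, j} \<in> E}"

end

theory Submission
  imports Defs
begin

text \<open>
  All ideals involved are monomial, so each statement becomes one about exponent vectors: a monomial
  lies in \<open>I\<^sup>2\<close> iff it is divisible by the product of two edge monomials, and in the
  \<open>k\<close>-th power of the prime generated by the variables in \<open>A\<close> iff it has degree at
  least \<open>k\<close> in these variables. The associated primes of a monomial ideal are generated by
  variables and are annihilators of monomials (\<open>Ass_quot_polys_on\<close>); the proof compares leading
  terms for a linear order on the exponent vectors.

  The combinatorial core is \<open>not_two_edges_cases\<close>. If a monomial is not in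
  \<open>I\<^sup>2\<close>, then the edges inside its support pairwise intersect. So either there are none,
  or they form a star whose centre has exponent \<open>1\<close>, or they form a triangle with exponents
  \<open>1\<close> that has no neighbours in the support outside itself. If the triangle is central, it is
  therefore the whole support.

  Suppose all triangles are central. Then \<open>I\<^sup>2\<close> is the intersection of
  \<open>\<mm>\<^sup>4\<close> with the squares of the primes of all vertex covers: in the first two cases a vertex
  cover of degree at most \<open>1\<close> excludes the monomial, in the third case the monomial has degree
  \<open>3\<close>. Moreover, analysing the three cases for a monomial whose annihilator is prime shows that
  this prime belongs to a minimal vertex cover or is \<open>\<mm>\<close>.

  Conversely, let \<open>v\<close> be a vertex without neighbour in a triangle \<open>C\<close>. The product of
  \<open>x\<^sub>C\<close> with a high power of \<open>x\<^sub>v\<close> cannot be excluded from \<open>I\<^sup>2\<close>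
  by powers of primes. The product of \<open>x\<^sub>C\<close> with the variables of a maximal independent set
  containing \<open>v\<close> and avoiding the neighbours of \<open>C\<close> has a prime annihilator that is
  neither \<open>\<mm>\<close> nor associated to \<open>I\<close>. So both other conditions fail
  (\<open>intersection_type_square_exps_iff\<close>, \<open>Ass_square_subset_iff\<close>).
\<close>

section \<open>Polynomials with exponents in a given set\<close>

definition exps :: "'v set \<Rightarrow> ('v \<Rightarrow>\<^sub>0 nat) set" where
  "exps V = {m. Poly_Mapping.keys m \<subseteq> V}"

text \<open>
  Every ideal in the argument is monomial, hence spanned over the field by its monomials. Such an
  ideal is encoded by the set \<open>M\<close> of exponent vectors of these monomials, so that products,
  intersections and colon ideals turn into operations on sets of exponent vectors.
\<close>

definition polys_on :: "('v \<Rightarrow>\<^sub>0 nat) set \<Rightarrow> (('v \<Rightarrow>\<^sub>0 nat) \<Rightarrow>\<^sub>0 'k::field) set" where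
  "polys_on M = {p. Poly_Mapping.keys p \<subseteq> M}"

definition monomial_set :: "'v set \<Rightarrow> ('v \<Rightarrow>\<^sub>0 nat) set \<Rightarrow> bool" where
  "monomial_set V M \<longleftrightarrow> M \<subseteq> exps V \<and> (\<forall>a\<in>M. \<forall>b\<in>exps V. a + b \<in> M)"

abbreviation monom :: "('v \<Rightarrow>\<^sub>0 nat) \<Rightarrow> (('v \<Rightarrow>\<^sub>0 nat) \<Rightarrow>\<^sub>0 'k::field)" where
  "monom a \<equiv> Poly_Mapping.single a 1"

text \<open>
  The exponent vectors of the monomials in the prime ideal generated by the variables in \<open>A\<close>.
\<close>

definition meets :: "'v set \<Rightarrow> 'v set \<Rightarrow> ('v \<Rightarrow>\<^sub>0 nat) set" where
  "meets V A = {c \<in> exps V. Poly_Mapping.keys c \<inter> A \<noteq> {}}"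

lemma poly_ring_simps [simp]:
  "carrier (poly_ring V) = polys_on (exps V)"
  "p \<otimes>\<^bsub>poly_ring V\<^esub> q = p * q"
  "p \<oplus>\<^bsub>poly_ring V\<^esub> q = p + q"
  "\<one>\<^bsub>poly_ring V\<^esub> = 1"
  "\<zero>\<^bsub>poly_ring V\<^esub> = 0"
  by (auto simp: poly_ring_def exps_def polys_on_def)

lemma keys_add_nat: "Poly_Mapping.keys (a + b :: 'v \<Rightarrow>\<^sub>0 nat) = Poly_Mapping.keys a \<union> Poly_Mapping.keys b"
  by (auto simp: in_keys_iff lookup_add)

lemma exps_add [simp]: "a + b \<in> exps V \<longleftrightarrow> a \<in> exps V \<and> b \<in> exps V"
  by (auto simp: exps_def keys_add_nat)

lemma zero_in_exps [simp]: "0 \<in> exps V"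
  by (simp add: exps_def)

lemma single_in_exps [simp]: "Poly_Mapping.single v (Suc n) \<in> exps V \<longleftrightarrow> v \<in> V"
  by (auto simp: exps_def)

lemma single_in_polys_on: "a \<in> M \<Longrightarrow> Poly_Mapping.single a c \<in> polys_on M"
  by (simp add: polys_on_def)

lemma monom_in_polys_on_iff [simp]: "(monom a :: _ \<Rightarrow>\<^sub>0 'k::field) \<in> polys_on M \<longleftrightarrow> a \<in> M"
  by (simp add: polys_on_def)

lemma zero_in_polys_on [simp]: "0 \<in> polys_on M"
  by (simp add: polys_on_def)

lemma polys_on_add: "p \<in> polys_on M \<Longrightarrow> q \<in> polys_on M \<Longrightarrow> p + q \<in> polys_on M"
  using Poly_Mapping.keys_add[of p q] by (auto simp: polys_on_def)

lemma keys_uminus_field: "Poly_Mapping.keys (- p) = Poly_Mapping.keys (p :: _ \<Rightarrow>\<^sub>0 'k::field)"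
  by (auto simp: in_keys_iff)

lemma polys_on_diff: "p \<in> polys_on M \<Longrightarrow> q \<in> polys_on M \<Longrightarrow> p - q \<in> polys_on M"
  using polys_on_add[of p M "- q"] by (simp add: polys_on_def keys_uminus_field)

lemma polys_on_mult:
  assumes "p \<in> polys_on M" "q \<in> polys_on N" "\<And>a b. a \<in> M \<Longrightarrow> b \<in> N \<Longrightarrow> a + b \<in> L"
  shows "p * q \<in> polys_on L"
  using assms Poly_Mapping.keys_mult[of p q] by (fastforce simp: polys_on_def)

lemma polys_on_mono: "M \<subseteq> N \<Longrightarrow> polys_on M \<subseteq> polys_on N"
  by (auto simp: polys_on_def)

lemma polys_on_inject: "(polys_on M :: (_ \<Rightarrow>\<^sub>0 'k::field) set) = polys_on N \<longleftrightarrow> M = N"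
proof
  assume eq: "(polys_on M :: (_ \<Rightarrow>\<^sub>0 'k) set) = polys_on N"
  have "a \<in> M \<longleftrightarrow> a \<in> N" for a
    using monom_in_polys_on_iff[of a M, where 'k='k] monom_in_polys_on_iff[of a N, where 'k='k] eq
    by simp
  then show "M = N" by blast
qed simp

text \<open>
  The sum of the terms of \<open>p\<close> with exponent in \<open>T\<close>. It serves to split off the
  leading term, and to discard the terms that already lie in a monomial ideal.
\<close>

definition part :: "'a set \<Rightarrow> ('a \<Rightarrow>\<^sub>0 'k::field) \<Rightarrow> ('a \<Rightarrow>\<^sub>0 'k)" where
  "part T p = (\<Sum>m\<in>Poly_Mapping.keys p \<inter> T. Poly_Mapping.single m (Poly_Mapping.lookup p m))"

lemma lookup_part: "Poly_Mapping.lookup (part T p) m = (if m \<in> T then Poly_Mapping.lookup p m else 0)"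
proof -
  have "Poly_Mapping.lookup (part T p) m
      = (\<Sum>x\<in>Poly_Mapping.keys p \<inter> T. if x = m then Poly_Mapping.lookup p m else 0)"
    unfolding part_def lookup_sum by (intro sum.cong) (auto simp: lookup_single)
  then show ?thesis by (auto simp: in_keys_iff)
qed

lemma keys_part [simp]: "Poly_Mapping.keys (part T p) = Poly_Mapping.keys p \<inter> T"
  by (auto simp: in_keys_iff lookup_part split: if_splits)

lemma part_keys_subset: "Poly_Mapping.keys p \<subseteq> T \<Longrightarrow> part T p = p"
  by (intro poly_mapping_eqI) (auto simp: lookup_part in_keys_iff)

lemma part_split: "p = part T p + part (- T) p"
  by (intro poly_mapping_eqI) (auto simp: lookup_part lookup_add)

lemma lookup_single_mult:
  fixes p :: "('v \<Rightarrow>\<^sub>0 nat) \<Rightarrow>\<^sub>0 'k::field"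
  shows "Poly_Mapping.lookup (Poly_Mapping.single m c * p) (m + k) = c * Poly_Mapping.lookup p k"
proof -
  have "Poly_Mapping.single m c * p = Poly_Mapping.single m c * part UNIV p"
    by (simp add: part_keys_subset)
  also have "\<dots> = (\<Sum>x\<in>Poly_Mapping.keys p. Poly_Mapping.single (m + x) (c * Poly_Mapping.lookup p x))"
    by (simp add: part_def sum_distrib_left mult_single)
  finally have "Poly_Mapping.lookup (Poly_Mapping.single m c * p) (m + k)
      = (\<Sum>x\<in>Poly_Mapping.keys p. if x = k then c * Poly_Mapping.lookup p k else 0)"
    by (simp add: lookup_sum lookup_single when_def if_distrib cong: if_cong)
  then show ?thesis by (auto simp: in_keys_iff)
qed

lemma keys_monom_mult:
  fixes p :: "('v \<Rightarrow>\<^sub>0 nat) \<Rightarrow>\<^sub>0 'k::field"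
  shows "Poly_Mapping.keys (monom m * p) = (+) m ` Poly_Mapping.keys p"
proof
  show "Poly_Mapping.keys (monom m * p) \<subseteq> (+) m ` Poly_Mapping.keys p"
    using Poly_Mapping.keys_mult[of "monom m" p] by auto
  show "(+) m ` Poly_Mapping.keys p \<subseteq> Poly_Mapping.keys (monom m * p)"
    by (auto simp: in_keys_iff lookup_single_mult)
qed

text \<open>
  Addition of exponent vectors is strictly monotone for the linear order, so
  every other product of two terms has a smaller exponent and cannot cancel the leading one. This
  is what the linear order on the variables is for.
\<close>

lemma leading_monomial_mult:
  fixes p q :: "('v::linorder \<Rightarrow>\<^sub>0 nat) \<Rightarrow>\<^sub>0 'k::field"
  assumes "p \<noteq> 0" "q \<noteq> 0"
  shows "Max (Poly_Mapping.keys p) + Max (Poly_Mapping.keys q) \<in> Poly_Mapping.keys (p * q)"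
proof -
  let ?m = "Max (Poly_Mapping.keys p)" and ?u = "Max (Poly_Mapping.keys q)"
  have m: "?m \<in> Poly_Mapping.keys p" and u: "?u \<in> Poly_Mapping.keys q"
    using assms by (auto intro!: Max_in)
  define p' where "p' = part (- {?m}) p"
  define c where "c = Poly_Mapping.lookup p ?m"
  have p: "p = Poly_Mapping.single ?m c + p'"
    using part_split[of p "{?m}"] m by (simp add: part_def p'_def c_def)
  have lt: "a < ?m" if "a \<in> Poly_Mapping.keys p'" for a
    using that Max_ge[of "Poly_Mapping.keys p" a] by (auto simp: p'_def order.strict_iff_order)
  have "?m + ?u \<notin> Poly_Mapping.keys (p' * q)"
  proof
    assume "?m + ?u \<in> Poly_Mapping.keys (p' * q)"
    then obtain a b where ab: "?m + ?u = a + b" "a \<in> Poly_Mapping.keys p'" "b \<in> Poly_Mapping.keys q"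
      using Poly_Mapping.keys_mult[of p' q] by auto
    have "a + b < ?m + ?u"
      using lt[OF ab(2)] Max_ge[OF _ ab(3)] by (intro add_less_le_mono) auto
    with ab(1) show False by simp
  qed
  then have "Poly_Mapping.lookup (p * q) (?m + ?u) = c * Poly_Mapping.lookup q ?u"
    by (subst p) (simp add: distrib_right lookup_add lookup_single_mult in_keys_iff)
  then show ?thesis
    using m u by (simp add: in_keys_iff c_def)
qed

section \<open>Monomial ideals, their products and powers\<close>

lemma poly_ring_ideal_closed:
  assumes "ideal J (poly_ring V)"
  shows "0 \<in> J"
    and "p \<in> J \<Longrightarrow> q \<in> J \<Longrightarrow> p + q \<in> J"
    and "p \<in> J \<Longrightarrow> r \<in> polys_on (exps V) \<Longrightarrow> r * p \<in> J"
    and "J \<subseteq> polys_on (exps V)"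
proof -
  interpret ideal J "poly_ring V" by fact
  show "0 \<in> J" using additive_subgroup.zero_closed[OF is_additive_subgroup] by simp
  show "p \<in> J \<Longrightarrow> q \<in> J \<Longrightarrow> p + q \<in> J" using additive_subgroup.a_closed[OF is_additive_subgroup, of p q] by simp
  show "p \<in> J \<Longrightarrow> r \<in> polys_on (exps V) \<Longrightarrow> r * p \<in> J" using I_l_closed[of p r] by simp
  show "J \<subseteq> polys_on (exps V)" using a_subset by simp
qed

lemma polys_on_subset_ideal:
  fixes J :: "(('v \<Rightarrow>\<^sub>0 nat) \<Rightarrow>\<^sub>0 'k::field) set"
  assumes J: "ideal J (poly_ring V)" and M: "\<And>a c. a \<in> M \<Longrightarrow> Poly_Mapping.single a c \<in> J"
  shows "polys_on M \<subseteq> J"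
proof
  fix p :: "('v \<Rightarrow>\<^sub>0 nat) \<Rightarrow>\<^sub>0 'k" assume p: "p \<in> polys_on M"
  have "sum f T \<in> J" if "finite T" "\<And>x. x \<in> T \<Longrightarrow> f x \<in> J" for f :: "('v \<Rightarrow>\<^sub>0 nat) \<Rightarrow> (('v \<Rightarrow>\<^sub>0 nat) \<Rightarrow>\<^sub>0 'k)" and T
    using that by (induction T rule: finite_induct) (auto intro: poly_ring_ideal_closed[OF J])
  from this have "part UNIV p \<in> J"
    unfolding part_def by (rule) (use p M in \<open>auto simp: polys_on_def\<close>)
  then show "p \<in> J" by (simp add: part_keys_subset)
qed

lemma ideal_polys_on:
  assumes "monomial_set V M"
  shows "ideal (polys_on M :: (_ \<Rightarrow>\<^sub>0 'k::field) set) (poly_ring V)"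
proof -
  let ?R = "poly_ring V :: (_ \<Rightarrow>\<^sub>0 'k) ring"
  interpret R: cring ?R by (rule poly_ring_cring)
  have sub: "M \<subseteq> exps V" and add: "\<And>a b. a \<in> M \<Longrightarrow> b \<in> exps V \<Longrightarrow> a + b \<in> M"
    using assms by (auto simp: monomial_set_def)
  have subg: "subgroup (polys_on M :: (_ \<Rightarrow>\<^sub>0 'k) set) (add_monoid ?R)"
  proof (rule group.subgroupI[OF R.a_group])
    show "(polys_on M :: (_ \<Rightarrow>\<^sub>0 'k) set) \<subseteq> carrier (add_monoid ?R)"
      using polys_on_mono[OF sub] by simp
    show "(polys_on M :: (_ \<Rightarrow>\<^sub>0 'k) set) \<noteq> {}" using zero_in_polys_on by blast
    fix p :: "_ \<Rightarrow>\<^sub>0 'k" assume p: "p \<in> polys_on M"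
    then have "p \<in> carrier ?R" and "- p \<in> carrier ?R" and "- p \<in> polys_on M"
      using sub by (auto simp: polys_on_def keys_uminus_field)
    moreover have "inv\<^bsub>add_monoid ?R\<^esub> p = - p"
      using calculation R.minus_equality[of "- p" p] unfolding a_inv_def by simp
    ultimately show "inv\<^bsub>add_monoid ?R\<^esub> p \<in> polys_on M" by simp
  next
    fix p q :: "_ \<Rightarrow>\<^sub>0 'k" assume "p \<in> polys_on M" "q \<in> polys_on M"
    then show "p \<otimes>\<^bsub>add_monoid ?R\<^esub> q \<in> polys_on M"
      using polys_on_add[of p M q] by simp
  qed
  show ?thesis
  proof (rule idealI[OF R.ring_axioms subg])
    fix p x :: "_ \<Rightarrow>\<^sub>0 'k" assume p: "p \<in> polys_on M" and x: "x \<in> carrier ?R"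
    show "p \<otimes>\<^bsub>?R\<^esub> x \<in> polys_on M"
      using polys_on_mult[of p M x "exps V" M] p x add by simp
    then show "x \<otimes>\<^bsub>?R\<^esub> p \<in> polys_on M" by (simp add: mult.commute)
  qed
qed

lemma genideal_monomials:
  assumes "G \<subseteq> exps V"
  shows "Idl\<^bsub>poly_ring V\<^esub> (monom ` G) = (polys_on {g + b | g b. g \<in> G \<and> b \<in> exps V} :: (_ \<Rightarrow>\<^sub>0 'k::field) set)"
    (is "_ = polys_on ?M")
proof -
  let ?R = "poly_ring V :: (_ \<Rightarrow>\<^sub>0 'k) ring"
  interpret R: cring ?R by (rule poly_ring_cring)
  have gen: "monom ` G \<subseteq> carrier ?R" using assms by auto
  have J: "ideal (Idl\<^bsub>?R\<^esub> (monom ` G)) ?R" by (rule R.genideal_ideal[OF gen])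
  have "monomial_set V ?M"
    unfolding monomial_set_def
  proof (intro conjI ballI)
    show "?M \<subseteq> exps V" using assms by auto
  next
    fix a b assume "a \<in> ?M" "b \<in> exps V"
    then obtain g c where "a = g + c" "g \<in> G" "c \<in> exps V" by blast
    with \<open>b \<in> exps V\<close> have "a + b = g + (c + b)" "c + b \<in> exps V"
      by (simp_all add: add.assoc)
    with \<open>g \<in> G\<close> show "a + b \<in> ?M" by blast
  qed
  then have "ideal (polys_on ?M :: (_ \<Rightarrow>\<^sub>0 'k) set) ?R" by (rule ideal_polys_on)
  moreover have "g \<in> ?M" if "g \<in> G" for g
    using that by (intro CollectI exI[of _ g] exI[of _ 0]) simp
  ultimately have "Idl\<^bsub>?R\<^esub> (monom ` G) \<subseteq> polys_on ?M"
    by (intro R.genideal_minimal) auto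
  moreover have "polys_on ?M \<subseteq> Idl\<^bsub>?R\<^esub> (monom ` G)"
  proof (rule polys_on_subset_ideal[OF J])
    fix a and c :: 'k assume "a \<in> ?M"
    then obtain g b where a: "a = g + b" "g \<in> G" "b \<in> exps V" by blast
    have "monom g \<in> Idl\<^bsub>?R\<^esub> (monom ` G)"
      using R.genideal_self[OF gen] a(2) by auto
    then have "Poly_Mapping.single b c * monom g \<in> Idl\<^bsub>?R\<^esub> (monom ` G)"
      using a(3) by (intro poly_ring_ideal_closed(3)[OF J]) (auto simp: single_in_polys_on)
    then show "Poly_Mapping.single a c \<in> Idl\<^bsub>?R\<^esub> (monom ` G)"
      by (simp add: mult_single a(1) add.commute)
  qed
  ultimately show ?thesis by blast
qed

lemma ideal_prod_polys_on:
  assumes M: "monomial_set V M" and N: "monomial_set V N"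
  shows "ideal_prod (poly_ring V) (polys_on M) (polys_on N)
    = (polys_on {a + b | a b. a \<in> M \<and> b \<in> N} :: (_ \<Rightarrow>\<^sub>0 'k::field) set)" (is "?P = polys_on ?L")
proof
  let ?R = "poly_ring V :: (_ \<Rightarrow>\<^sub>0 'k) ring"
  interpret R: cring ?R by (rule poly_ring_cring)
  show "?P \<subseteq> polys_on ?L"
  proof
    fix p :: "_ \<Rightarrow>\<^sub>0 'k" assume "p \<in> ?P"
    then show "p \<in> polys_on ?L"
      by (induction rule: ideal_prod.induct)
         (auto intro!: polys_on_add intro: polys_on_mult)
  qed
  have J: "ideal ?P ?R"
    by (rule R.ideal_prod_is_ideal[OF ideal_polys_on[OF M] ideal_polys_on[OF N]])
  show "polys_on ?L \<subseteq> ?P"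
  proof (rule polys_on_subset_ideal[OF J])
    fix x and c :: 'k assume "x \<in> ?L"
    then obtain a b where x: "x = a + b" "a \<in> M" "b \<in> N" by blast
    have "Poly_Mapping.single a c \<otimes>\<^bsub>?R\<^esub> monom b \<in> ?P"
      using x by (intro ideal_prod.prod) (auto simp: single_in_polys_on)
    then show "Poly_Mapping.single x c \<in> ?P" by (simp add: mult_single x(1))
  qed
qed

lemma monomial_set_exps: "monomial_set V (exps V)"
  by (simp add: monomial_set_def)

lemma ideal_power_0: "ideal_power R I 0 = carrier R"
  by (simp add: nat_pow_def ideals_set_def)

lemma ideal_power_Suc: "ideal_power R I (Suc k) = ideal_prod R (ideal_power R I k) I"
  by (simp add: nat_pow_def ideals_set_def)

lemma ideal_power_2_polys_on:
  assumes "monomial_set V M"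
  shows "ideal_power (poly_ring V) (polys_on M) 2
    = (polys_on {a + b | a b. a \<in> M \<and> b \<in> M} :: (_ \<Rightarrow>\<^sub>0 'k::field) set)"
proof -
  have "ideal_prod (poly_ring V) (polys_on (exps V)) (polys_on M)
      = (polys_on M :: (_ \<Rightarrow>\<^sub>0 'k) set)"
  proof -
    have "{a + b | a b. a \<in> exps V \<and> b \<in> M} = M"
    proof (intro equalityI subsetI)
      fix x assume "x \<in> {a + b | a b. a \<in> exps V \<and> b \<in> M}"
      then obtain a b where "x = b + a" "a \<in> exps V" "b \<in> M" by (auto simp: add.commute)
      then show "x \<in> M" using assms by (simp add: monomial_set_def)
    next
      fix x assume "x \<in> M"
      then show "x \<in> {a + b | a b. a \<in> exps V \<and> b \<in> M}"
        by (intro CollectI exI[of _ 0] exI[of _ x]) simp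
    qed
    then show ?thesis
      using ideal_prod_polys_on[OF monomial_set_exps assms, where 'k='k] by simp
  qed
  then show ?thesis
    using ideal_prod_polys_on[OF assms assms, where 'k='k]
    unfolding numeral_2_eq_2 ideal_power_Suc ideal_power_0 by simp
qed

section \<open>Monomial prime ideals\<close>

lemma monomial_set_meets: "monomial_set V (meets V A)"
  by (auto simp: monomial_set_def meets_def keys_add_nat)

lemma exponent_split:
  assumes "v \<in> Poly_Mapping.keys (a :: 'v \<Rightarrow>\<^sub>0 nat)"
  shows "a = Poly_Mapping.single v 1 + (a - Poly_Mapping.single v 1)"
  using assms by (intro poly_mapping_eqI) (auto simp: lookup_add lookup_minus lookup_single when_def in_keys_iff)

text \<open>
  A monomial is divisible by a variable from \<open>A\<close> exactly if its support meets \<open>A\<close>.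
\<close>

lemma genideal_Var:
  assumes "A \<subseteq> V"
  shows "Idl\<^bsub>poly_ring V\<^esub> (Var ` A) = (polys_on (meets V A) :: (_ \<Rightarrow>\<^sub>0 'k::field) set)"
proof -
  have *: "Var ` A = monom ` (\<lambda>v. Poly_Mapping.single v 1) ` A"
    by (auto simp: Var_def image_image)
  have "{g + b | g b. g \<in> (\<lambda>v. Poly_Mapping.single v 1) ` A \<and> b \<in> exps V} = meets V A" (is "?L = _")
  proof (intro equalityI subsetI)
    fix x assume "x \<in> ?L"
    with assms show "x \<in> meets V A" by (auto simp: meets_def keys_add_nat)
  next
    fix x assume x: "x \<in> meets V A"
    then obtain v where v: "v \<in> Poly_Mapping.keys x" "v \<in> A" by (auto simp: meets_def)
    note split = exponent_split[OF v(1)]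
    then have "x - Poly_Mapping.single v 1 \<in> exps V"
      using x by (metis (no_types, lifting) exps_add meets_def mem_Collect_eq)
    then show "x \<in> ?L" using split v(2) by blast
  qed
  then show ?thesis
    unfolding * using assms by (subst genideal_monomials) (auto simp: exps_def)
qed

text \<open>
  The \<open>k\<close>-th power of a monomial prime consists of the polynomials of degree at least
  \<open>k\<close> in the variables from \<open>A\<close>: a monomial of degree \<open>k + 1\<close> in these
  variables still has degree \<open>k\<close> after one of them is split off.
\<close>

lemma ideal_power_meets:
  assumes A: "A \<subseteq> V" "finite A"
  shows "ideal_power (poly_ring V) (polys_on (meets V A)) k
    = (polys_on {a \<in> exps V. k \<le> (\<Sum>v\<in>A. Poly_Mapping.lookup a v)} :: (_ \<Rightarrow>\<^sub>0 'k::field) set)"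
proof (induction k)
  case 0
  show ?case unfolding ideal_power_0 by simp
next
  case (Suc k)
  let ?d = "\<lambda>a. \<Sum>v\<in>A. Poly_Mapping.lookup a v" and ?M = "\<lambda>k. {a \<in> exps V. k \<le> (\<Sum>v\<in>A. Poly_Mapping.lookup a v)}"
  have M: "monomial_set V (?M k)"
    by (auto simp: monomial_set_def lookup_add sum.distrib)
  have pos: "1 \<le> ?d b" if "b \<in> meets V A" for b
  proof -
    obtain v where v: "v \<in> Poly_Mapping.keys b" "v \<in> A" using \<open>b \<in> _\<close> by (auto simp: meets_def)
    then have "1 \<le> Poly_Mapping.lookup b v" by (simp add: in_keys_iff)
    also have "\<dots> \<le> ?d b" using v A by (intro member_le_sum) auto
    finally show ?thesis .
  qed
  have "{a + b | a b. a \<in> ?M k \<and> b \<in> meets V A} = ?M (Suc k)" (is "?L = _")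
  proof (intro equalityI subsetI)
    fix x assume "x \<in> ?L"
    then obtain a b where x: "x = a + b" "a \<in> ?M k" "b \<in> meets V A" by blast
    then show "x \<in> ?M (Suc k)"
      using pos[OF x(3)] by (auto simp: lookup_add sum.distrib meets_def)
  next
    fix x assume x: "x \<in> ?M (Suc k)"
    then have "?d x \<noteq> 0" by auto
    then obtain v where v: "v \<in> A" "Poly_Mapping.lookup x v \<noteq> 0"
      by (meson sum.neutral)
    let ?y = "x - Poly_Mapping.single v 1"
    have split: "x = Poly_Mapping.single v 1 + ?y"
      using v by (intro exponent_split) (simp add: in_keys_iff)
    have "?d x = ?d (Poly_Mapping.single v 1) + ?d ?y"
      by (subst split) (simp add: lookup_add sum.distrib)
    also have "?d (Poly_Mapping.single v 1) = 1"
      using v A by (simp add: lookup_single when_def)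
    finally have "k \<le> ?d ?y" using x by simp
    moreover have "?y \<in> exps V"
      using x split by (metis (no_types, lifting) exps_add mem_Collect_eq)
    moreover have "Poly_Mapping.single v 1 \<in> meets V A"
      using v A by (auto simp: meets_def exps_def)
    ultimately show "x \<in> ?L"
      using split x by (intro CollectI exI[of _ ?y] exI[of _ "Poly_Mapping.single v 1"])
        (simp add: add.commute)
  qed
  then show ?case
    using ideal_prod_polys_on[OF M monomial_set_meets, where 'k='k] unfolding ideal_power_Suc Suc by simp
qed

text \<open>
  If neither factor lies in the ideal, the parts of the factors that avoid the variables from
  \<open>A\<close> are nonzero, their product is nonzero and avoids these variables, and modulo the
  ideal it agrees with the product of the factors.
\<close>

lemma primeideal_meets:
  fixes V :: "'v::linorder set"
  shows "primeideal (polys_on (meets V A) :: (_ \<Rightarrow>\<^sub>0 'k::field) set) (poly_ring V)"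
proof (rule primeidealI[OF ideal_polys_on[OF monomial_set_meets] poly_ring_cring])
  have "0 \<in> exps V" "0 \<notin> meets V A" by (auto simp: meets_def)
  then show "carrier (poly_ring V) \<noteq> (polys_on (meets V A) :: (_ \<Rightarrow>\<^sub>0 'k) set)"
    by (auto simp: polys_on_inject)
next
  fix p q :: "_ \<Rightarrow>\<^sub>0 'k"
  assume "p \<in> carrier (poly_ring V)" "q \<in> carrier (poly_ring V)" "p \<otimes>\<^bsub>poly_ring V\<^esub> q \<in> polys_on (meets V A)"
  then have p: "p \<in> polys_on (exps V)" and q: "q \<in> polys_on (exps V)" and pq: "p * q \<in> polys_on (meets V A)"
    by auto
  let ?N = "- meets V A"
  show "p \<in> polys_on (meets V A) \<or> q \<in> polys_on (meets V A)"
  proof (rule ccontr)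
    assume "\<not> ?thesis"
    then have "Poly_Mapping.keys (part ?N p) \<noteq> {}" "Poly_Mapping.keys (part ?N q) \<noteq> {}"
      by (auto simp: polys_on_def)
    then have nz: "part ?N p \<noteq> 0" "part ?N q \<noteq> 0" by (metis keys_zero)+
    then obtain k where k: "k \<in> Poly_Mapping.keys (part ?N p * part ?N q)"
      using leading_monomial_mult by blast
    then have "k \<notin> meets V A"
      using Poly_Mapping.keys_mult[of "part ?N p" "part ?N q"] p q
      by (force simp: meets_def polys_on_def keys_add_nat)
    have "part ?N p * part ?N q = p * q - part (meets V A) p * q - part ?N p * part (meets V A) q"
      by (subst (2) part_split[of q "meets V A"], subst (2) part_split[of p "meets V A"],
          subst (2) part_split[of q "meets V A"])
         (simp add: algebra_simps)
    also have "\<dots> \<in> polys_on (meets V A)"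
    proof (intro polys_on_diff pq)
      show "part (meets V A) p * q \<in> polys_on (meets V A)"
        by (rule polys_on_mult[of _ "meets V A" _ "exps V"])
           (use p q in \<open>auto simp: polys_on_def meets_def keys_add_nat\<close>)
      show "part ?N p * part (meets V A) q \<in> polys_on (meets V A)"
        by (rule polys_on_mult[of _ "exps V" _ "meets V A"])
           (use p q in \<open>auto simp: polys_on_def meets_def keys_add_nat\<close>)
    qed
    finally show False using k \<open>k \<notin> meets V A\<close> by (auto simp: polys_on_def)
  qed
qed

section \<open>Associated primes of monomial ideals\<close>

text \<open>
  An element of \<open>R/J\<close> is the class of some \<open>f\<close>, and its annihilator is the colon
  ideal \<open>(J : f)\<close>; this removes quotient rings from the rest of the argument.
\<close>

lemma Ass_quot_iff:
  assumes "ideal J R" "cring R"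
  shows "P \<in> Ass_quot R J \<longleftrightarrow> primeideal P R \<and>
    (\<exists>f\<in>carrier R. P = {r \<in> carrier R. r \<otimes>\<^bsub>R\<^esub> f \<in> J})"
proof -
  interpret ideal J R by fact
  have *: "(J +>\<^bsub>R\<^esub> r) \<otimes>\<^bsub>R Quot J\<^esub> (J +>\<^bsub>R\<^esub> f) = \<zero>\<^bsub>R Quot J\<^esub> \<longleftrightarrow> r \<otimes>\<^bsub>R\<^esub> f \<in> J"
    if "r \<in> carrier R" "f \<in> carrier R" for r f
    using that rcoset_mult_add[OF that] a_rcos_self[of "r \<otimes>\<^bsub>R\<^esub> f"] a_rcos_const[of "r \<otimes>\<^bsub>R\<^esub> f"]
    by (auto simp: FactRing_def)
  have carr: "carrier (R Quot J) = (\<lambda>f. J +>\<^bsub>R\<^esub> f) ` carrier R"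
    by (auto simp: FactRing_def A_RCOSETS_def' image_def)
  show ?thesis
    unfolding Ass_quot_def carr by (auto simp: * cong: conj_cong)
qed

lemma keys_eq_empty_field: "Poly_Mapping.keys p = {} \<longleftrightarrow> p = 0" for p :: "'a \<Rightarrow>\<^sub>0 'b::zero"
  by (auto simp: poly_mapping_eq_iff in_keys_iff fun_eq_iff set_eq_iff)

lemma exponent_induct [case_names zero add]:
  fixes a :: "'v \<Rightarrow>\<^sub>0 nat"
  assumes "P 0" and step: "\<And>v a. P a \<Longrightarrow> P (Poly_Mapping.single v 1 + a)"
  shows "P a"
proof (induction "\<Sum>v\<in>Poly_Mapping.keys a. Poly_Mapping.lookup a v" arbitrary: a rule: less_induct)
  case less
  show ?case
  proof (cases "a = 0")
    case False
    then obtain v where v: "v \<in> Poly_Mapping.keys a"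
      using keys_eq_empty_field[of a] by blast
    let ?b = "a - Poly_Mapping.single v 1"
    have "(\<Sum>x\<in>Poly_Mapping.keys ?b. Poly_Mapping.lookup ?b x) \<le> (\<Sum>x\<in>Poly_Mapping.keys a. Poly_Mapping.lookup ?b x)"
      by (rule sum_mono2) (auto simp: in_keys_iff lookup_minus)
    also have "\<dots> < (\<Sum>x\<in>Poly_Mapping.keys a. Poly_Mapping.lookup a x)"
      by (rule sum_strict_mono_ex1) (use v in \<open>auto simp: in_keys_iff lookup_minus lookup_single intro!: bexI[of _ v]\<close>)
    finally have "P ?b" by (rule less)
    then show ?thesis
      using step[of ?b v] exponent_split[OF v] by simp
  qed (simp add: assms(1))
qed

text \<open>
  If \<open>p\<close> sends \<open>f\<close> into a monomial ideal, then the leading monomial of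
  \<open>p\<close> sends into it the leading one among the terms of \<open>f\<close> outside the ideal.
  Multiplying \<open>f\<close> by the leading monomial of \<open>p\<close> thus leaves fewer terms outside,
  and after finitely many multiplications none is left.
\<close>

lemma leading_monomial_power_annihilates:
  fixes p f :: "('v::linorder \<Rightarrow>\<^sub>0 nat) \<Rightarrow>\<^sub>0 'k::field"
  assumes M: "monomial_set V M" and "p \<noteq> 0" and p: "p \<in> polys_on (exps V)"
    and "f \<in> polys_on (exps V)" "p * f \<in> polys_on M"
  shows "\<exists>k. monom (Max (Poly_Mapping.keys p)) ^ k * f \<in> polys_on M"
  using assms(4,5)
proof (induction "card (Poly_Mapping.keys f - M)" arbitrary: f rule: less_induct)
  case less
  let ?m = "Max (Poly_Mapping.keys p)"
  note J = poly_ring_ideal_closed[OF ideal_polys_on[OF M]]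
  have m: "?m \<in> exps V"
    using p Max_in[of "Poly_Mapping.keys p"] \<open>p \<noteq> 0\<close> by (auto simp: polys_on_def)
  show ?case
  proof (cases "part (- M) f = 0")
    case True
    then have "f \<in> polys_on M" by (subst part_split[of f M]) (simp add: polys_on_def)
    then show ?thesis by (intro exI[of _ 0]) simp
  next
    case False
    let ?f = "part (- M) f" and ?g = "monom ?m * f"
    let ?u = "Max (Poly_Mapping.keys ?f)"
    have u: "?u \<in> Poly_Mapping.keys f - M"
      using Max_in[OF finite_keys, of ?f] False by (simp only: keys_eq_empty_field) auto
    have "part M f \<in> polys_on M" by (simp add: polys_on_def)
    then have "p * f - p * part M f \<in> polys_on M"
      by (intro polys_on_diff less.prems J(3) p)
    moreover have "p * f - p * part M f = p * ?f"
      by (subst part_split[of f M]) (simp add: algebra_simps)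
    ultimately have "?m + ?u \<in> M"
      using leading_monomial_mult[OF \<open>p \<noteq> 0\<close> False] by (auto simp: polys_on_def)
    then have "Poly_Mapping.keys ?g - M \<subseteq> (+) ?m ` (Poly_Mapping.keys f - M - {?u})"
      using M m by (auto simp: keys_monom_mult monomial_set_def add.commute)
    then have "card (Poly_Mapping.keys ?g - M) \<le> card (Poly_Mapping.keys f - M - {?u})"
      by (meson card_image_le card_mono finite_Diff finite_imageI finite_keys le_trans)
    also have "\<dots> < card (Poly_Mapping.keys f - M)"
      using u by (intro card_Diff1_less) auto
    finally have lt: "card (Poly_Mapping.keys ?g - M) < card (Poly_Mapping.keys f - M)" .
    have "?g \<in> polys_on (exps V)"
      by (rule polys_on_mult[of _ "exps V" _ "exps V"]) (use m less.prems in auto)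
    moreover have "p * ?g \<in> polys_on M"
      using J(3)[of "p * f" "monom ?m"] less.prems m by (simp add: mult.left_commute)
    ultimately obtain k where "monom ?m ^ k * ?g \<in> polys_on M"
      using less.hyps[OF lt] by blast
    then show ?thesis
      by (intro exI[of _ "Suc k"]) (simp add: mult_ac)
  qed
qed

text \<open>
  A prime annihilator contains the leading monomial of each of its elements, since it
  contains a power of it by the preceding lemma. Subtracting the leading term and repeating gives
  all the monomials.
\<close>

lemma prime_annihilator_monomial:
  fixes P :: "(('v::linorder \<Rightarrow>\<^sub>0 nat) \<Rightarrow>\<^sub>0 'k::field) set"
  assumes M: "monomial_set V M" and prime: "primeideal P (poly_ring V)"
    and f: "f \<in> polys_on (exps V)" and P: "P = {r \<in> polys_on (exps V). r * f \<in> polys_on M}"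
    and "p \<in> P" "a \<in> Poly_Mapping.keys p"
  shows "monom a \<in> P"
  using assms(5,6)
proof (induction "card (Poly_Mapping.keys p)" arbitrary: p rule: less_induct)
  case less
  interpret primeideal P "poly_ring V" by fact
  let ?m = "Max (Poly_Mapping.keys p)"
  have "p \<noteq> 0" using less.prems(2) by auto
  have p: "p \<in> polys_on (exps V)" "p * f \<in> polys_on M" using less.prems(1) P by auto
  have m: "?m \<in> Poly_Mapping.keys p" using \<open>p \<noteq> 0\<close> by (auto intro!: Max_in)
  then have mV: "?m \<in> exps V" using p(1) by (auto simp: polys_on_def)
  have powV: "monom ?m ^ k \<in> (polys_on (exps V) :: (_ \<Rightarrow>\<^sub>0 'k) set)" for k
  proof (induction k)
    case (Suc k)
    then show ?case
      using polys_on_mult[of "monom ?m" "exps V" "monom ?m ^ k" "exps V" "exps V"] mV by simp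
  qed (simp add: polys_on_def)
  obtain k where "monom ?m ^ k * f \<in> polys_on M"
    using leading_monomial_power_annihilates[OF M \<open>p \<noteq> 0\<close> p(1) f p(2)] by blast
  then have "monom ?m ^ k \<in> P" using P powV by blast
  then have mP: "monom ?m \<in> P"
  proof (induction k)
    case 0
    then show ?case using one_imp_carrier I_notcarr by simp
  next
    case (Suc k)
    then show ?case using I_prime[of "monom ?m" "monom ?m ^ k"] mV powV by auto
  qed
  show ?case
  proof (cases "a = ?m")
    case True
    then show ?thesis using mP by simp
  next
    case False
    let ?q = "part (- {?m}) p"
    have J: "ideal P (poly_ring V)" by (rule is_ideal)
    have "part {?m} p = Poly_Mapping.single 0 (Poly_Mapping.lookup p ?m) * monom ?m"
      using m by (simp add: part_def mult_single)
    also have "- 1 * \<dots> \<in> P"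
      by (intro poly_ring_ideal_closed(3)[OF J] mP) (auto simp: polys_on_def keys_uminus_field)
    finally have "p + - 1 * part {?m} p \<in> P"
      by (intro poly_ring_ideal_closed(2)[OF J] less.prems)
    then have "?q \<in> P"
      by (subst (asm) (1) part_split[of p "{?m}"]) simp
    moreover have "card (Poly_Mapping.keys ?q) < card (Poly_Mapping.keys p)"
      using m by (intro psubset_card_mono) auto
    ultimately show ?thesis
      using less.hyps[of ?q] less.prems(2) False by auto
  qed
qed

text \<open>
  Being prime and spanned by its monomials, \<open>P\<close> is generated by the variables in
  it. If every term \<open>u\<close> of \<open>f\<close> were sent into the ideal by some monomial
  \<open>b u\<close> outside \<open>P\<close>, then the product of these monomials would send all of
  \<open>f\<close> into it, although it is outside \<open>P\<close>. So \<open>P\<close> is already the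
  annihilator of a single term.
\<close>

lemma Ass_quot_polys_on:
  fixes V :: "'v::linorder set" and P :: "(('v \<Rightarrow>\<^sub>0 nat) \<Rightarrow>\<^sub>0 'k::field) set"
  assumes M: "monomial_set V M"
  shows "P \<in> Ass_quot (poly_ring V) (polys_on M) \<longleftrightarrow>
    (\<exists>A\<subseteq>V. P = polys_on (meets V A) \<and>
       (\<exists>a\<in>exps V. \<forall>c\<in>exps V. a + c \<in> M \<longleftrightarrow> Poly_Mapping.keys c \<inter> A \<noteq> {}))"
proof -
  let ?J = "polys_on M :: (('v \<Rightarrow>\<^sub>0 nat) \<Rightarrow>\<^sub>0 'k) set"
  note Ass = Ass_quot_iff[OF ideal_polys_on[OF M] poly_ring_cring, simplified]
  show ?thesis
  proof
    assume "P \<in> Ass_quot (poly_ring V) ?J"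
    then obtain f where prime: "primeideal P (poly_ring V)" and f: "f \<in> polys_on (exps V)"
      and P: "P = {r \<in> polys_on (exps V). r * f \<in> ?J}"
      unfolding Ass by auto
    interpret primeideal P "poly_ring V" by fact
    define A where "A = {v \<in> V. Var v \<in> P}"
    note ann = prime_annihilator_monomial[OF M prime f P]
    note J = poly_ring_ideal_closed[OF is_ideal]
    have monom: "a \<in> exps V \<Longrightarrow> Poly_Mapping.keys a \<inter> A \<noteq> {}" if "monom a \<in> P" for a
      using that
    proof (induction a rule: exponent_induct)
      case zero
      then show ?case using one_imp_carrier I_notcarr by simp
    next
      case (add v a)
      then have "Var v * monom a \<in> P" by (simp add: Var_def mult_single)
      then show ?case
        using I_prime[of "Var v" "monom a"] add
        by (auto simp: A_def Var_def keys_add_nat)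
    qed
    have PA: "P = polys_on (meets V A)"
    proof
      show "P \<subseteq> polys_on (meets V A)"
        using ann monom J(4) by (fastforce simp: polys_on_def meets_def)
      show "polys_on (meets V A) \<subseteq> P"
      proof (rule polys_on_subset_ideal[OF is_ideal])
        fix a and c :: 'k assume a: "a \<in> meets V A"
        then obtain v where v: "v \<in> Poly_Mapping.keys a" "v \<in> A" by (auto simp: meets_def)
        note split = exponent_split[OF v(1)]
        have "a - Poly_Mapping.single v 1 \<in> exps V"
          using split a by (metis (no_types, lifting) exps_add meets_def mem_Collect_eq)
        then have "Poly_Mapping.single (a - Poly_Mapping.single v 1) c * Var v \<in> P"
          using v(2) by (intro J(3)) (auto simp: A_def single_in_polys_on)
        also have "Poly_Mapping.single (a - Poly_Mapping.single v 1) c * Var v = Poly_Mapping.single a c"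
          using split by (simp add: Var_def mult_single add.commute)
        finally show "Poly_Mapping.single a c \<in> P" .
      qed
    qed
    have "\<exists>u\<in>Poly_Mapping.keys f. \<forall>b\<in>exps V. Poly_Mapping.keys b \<inter> A = {} \<longrightarrow> u + b \<notin> M"
    proof (rule ccontr)
      assume "\<not> ?thesis"
      then obtain b where b: "\<And>u. u \<in> Poly_Mapping.keys f \<Longrightarrow>
          b u \<in> exps V \<and> Poly_Mapping.keys (b u) \<inter> A = {} \<and> u + b u \<in> M"
        by metis
      define s where "s = sum b (Poly_Mapping.keys f)"
      have sum: "sum b T \<in> exps V \<and> Poly_Mapping.keys (sum b T) \<inter> A = {}"
        if "T \<subseteq> Poly_Mapping.keys f" for T
        using finite_subset[OF that finite_keys] that
        by (induction T rule: finite_induct) (use b in \<open>auto simp: keys_add_nat\<close>)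
      have "u + s \<in> M" if u: "u \<in> Poly_Mapping.keys f" for u
      proof -
        have "u + s = (u + b u) + sum b (Poly_Mapping.keys f - {u})"
          unfolding s_def by (subst sum.remove[OF _ u]) (auto simp: add.assoc)
        then show ?thesis using M b[OF u] sum[of "Poly_Mapping.keys f - {u}"] by (auto simp: monomial_set_def)
      qed
      then have "monom s * f \<in> ?J"
        by (auto simp: polys_on_def keys_monom_mult add.commute)
      moreover have s: "s \<in> exps V \<and> Poly_Mapping.keys s \<inter> A = {}"
        unfolding s_def by (rule sum) simp
      ultimately have "monom s \<in> P" using P by simp
      with monom s show False by blast
    qed
    then obtain u where u: "u \<in> Poly_Mapping.keys f"
      and avoid: "\<And>b. b \<in> exps V \<Longrightarrow> Poly_Mapping.keys b \<inter> A = {} \<Longrightarrow> u + b \<notin> M" by blast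
    have "u + c \<in> M" if c: "c \<in> exps V" "Poly_Mapping.keys c \<inter> A \<noteq> {}" for c
    proof -
      have "monom c \<in> P" using c PA by (simp add: meets_def)
      then have "monom c * f \<in> ?J" using P by blast
      then show ?thesis using u by (auto simp: polys_on_def keys_monom_mult add.commute)
    qed
    moreover have "u \<in> exps V" using u f by (auto simp: polys_on_def)
    moreover have "A \<subseteq> V" by (auto simp: A_def)
    ultimately show "\<exists>A\<subseteq>V. P = polys_on (meets V A) \<and>
        (\<exists>a\<in>exps V. \<forall>c\<in>exps V. a + c \<in> M \<longleftrightarrow> Poly_Mapping.keys c \<inter> A \<noteq> {})"
      using PA avoid by blast
  next
    assume "\<exists>A\<subseteq>V. P = polys_on (meets V A) \<and>
        (\<exists>a\<in>exps V. \<forall>c\<in>exps V. a + c \<in> M \<longleftrightarrow> Poly_Mapping.keys c \<inter> A \<noteq> {})"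
    then obtain A a where P: "P = polys_on (meets V A)" and a: "a \<in> exps V"
      and iff: "\<And>c. c \<in> exps V \<Longrightarrow> a + c \<in> M \<longleftrightarrow> Poly_Mapping.keys c \<inter> A \<noteq> {}"
      by blast
    have "r \<in> P \<longleftrightarrow> r \<in> polys_on (exps V) \<and> r * monom a \<in> ?J" for r
    proof -
      have "r * monom a \<in> ?J \<longleftrightarrow> (\<forall>c\<in>Poly_Mapping.keys r. a + c \<in> M)"
        unfolding mult.commute[of r] by (auto simp: polys_on_def keys_monom_mult)
      moreover have "r \<in> P \<longleftrightarrow> (\<forall>c\<in>Poly_Mapping.keys r. c \<in> exps V \<and> Poly_Mapping.keys c \<inter> A \<noteq> {})"
        unfolding P by (auto simp: polys_on_def meets_def)
      moreover have "r \<in> polys_on (exps V) \<longleftrightarrow> (\<forall>c\<in>Poly_Mapping.keys r. c \<in> exps V)"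
        by (auto simp: polys_on_def)
      ultimately show ?thesis using iff by blast
    qed
    then have "P = {r \<in> polys_on (exps V). r * monom a \<in> ?J}" by blast
    moreover have "primeideal P (poly_ring V)"
      unfolding P by (rule primeideal_meets)
    moreover have "(monom a :: _ \<Rightarrow>\<^sub>0 'k) \<in> polys_on (exps V)" using a by simp
    ultimately show "P \<in> Ass_quot (poly_ring V) ?J"
      unfolding Ass by blast
  qed
qed

section \<open>The square of an edge ideal\<close>

text \<open>
  The monomial with exponent vector \<open>a\<close> is divisible by the product of two edge monomials.
  The two edges may coincide or share a vertex, and a shared vertex needs exponent \<open>2\<close>.
\<close>

definition two_edges :: "'v set set \<Rightarrow> ('v \<Rightarrow> nat) \<Rightarrow> bool" where
  "two_edges E a \<longleftrightarrow> (\<exists>i j k l. {i, j} \<in> E \<and> {k, l} \<in> E \<and> 0 < a i \<and> 0 < a j \<and> 0 < a k \<and> 0 < a l \<and>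
     (i \<in> {k, l} \<longrightarrow> 2 \<le> a i) \<and> (j \<in> {k, l} \<longrightarrow> 2 \<le> a j))"

definition edge_exps :: "'v set \<Rightarrow> 'v set set \<Rightarrow> ('v \<Rightarrow>\<^sub>0 nat) set" where
  "edge_exps V E = {a \<in> exps V. \<exists>i j. {i, j} \<in> E \<and> i \<in> Poly_Mapping.keys a \<and> j \<in> Poly_Mapping.keys a}"

definition square_exps :: "'v set \<Rightarrow> 'v set set \<Rightarrow> ('v \<Rightarrow>\<^sub>0 nat) set" where
  "square_exps V E = {a \<in> exps V. two_edges E (Poly_Mapping.lookup a)}"

lemma two_edgesI:
  assumes "{i, j} \<in> E" "{k, l} \<in> E" "0 < a i" "0 < a j" "0 < a k" "0 < a l"
    "i \<in> {k, l} \<Longrightarrow> 2 \<le> a i" "j \<in> {k, l} \<Longrightarrow> 2 \<le> a j"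
  shows "two_edges E a"
  using assms unfolding two_edges_def by blast

lemma two_edgesE:
  assumes "two_edges E a"
  obtains i j k l where "{i, j} \<in> E" "{k, l} \<in> E" "0 < a i" "0 < a j" "0 < a k" "0 < a l"
    "i \<in> {k, l} \<longrightarrow> 2 \<le> a i" "j \<in> {k, l} \<longrightarrow> 2 \<le> a j"
  using assms unfolding two_edges_def by blast

lemma two_edges_mono:
  assumes "two_edges E a" "\<And>v. a v \<le> b v" shows "two_edges E b"
proof -
  obtain i j k l where "{i, j} \<in> E" "{k, l} \<in> E" "0 < a i" "0 < a j" "0 < a k" "0 < a l"
     "(i \<in> {k, l} \<longrightarrow> 2 \<le> a i) \<and> (j \<in> {k, l} \<longrightarrow> 2 \<le> a j)"
    using assms(1) unfolding two_edges_def by blast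
  then show ?thesis
    using assms(2)[of i] assms(2)[of j] assms(2)[of k] assms(2)[of l]
    by (intro two_edgesI[of i j E k l]) auto
qed

lemma monomial_set_edge_exps: "monomial_set V (edge_exps V E)"
  by (auto simp: monomial_set_def edge_exps_def keys_add_nat)

lemma monomial_set_square_exps: "monomial_set V (square_exps V E)"
  unfolding monomial_set_def square_exps_def
  by (auto simp: lookup_add elim!: two_edges_mono)

lemma simple_graph_edge:
  assumes "simple_graph V E" "{i, j} \<in> E" shows "i \<in> V" "j \<in> V" "i \<noteq> j"
  using assms by (auto simp: simple_graph_def)

lemma two_step_split:
  assumes "i \<noteq> j" "i \<in> Poly_Mapping.keys (a :: 'v \<Rightarrow>\<^sub>0 nat)" "j \<in> Poly_Mapping.keys a"
  shows "a = (Poly_Mapping.single i 1 + Poly_Mapping.single j 1)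
           + (a - (Poly_Mapping.single i 1 + Poly_Mapping.single j 1))"
  using assms by (intro poly_mapping_eqI) (auto simp: lookup_add lookup_minus lookup_single when_def in_keys_iff)

lemma edge_ideal_eq:
  assumes G: "simple_graph V E"
  shows "edge_ideal V E = (polys_on (edge_exps V E) :: (_ \<Rightarrow>\<^sub>0 'k::field) set)"
proof -
  let ?e = "\<lambda>i j. Poly_Mapping.single i 1 + Poly_Mapping.single j (1::nat)"
  define G where "G = {?e i j | i j. {i, j} \<in> E}"
  have *: "{Var i * Var j | i j. {i, j} \<in> E} = (monom ` G :: (_ \<Rightarrow>\<^sub>0 'k) set)"
    by (auto simp: G_def Var_def mult_single image_iff)
  have "G \<subseteq> exps V"
    using simple_graph_edge[OF assms] by (auto simp: G_def)
  moreover have "{g + b | g b. g \<in> G \<and> b \<in> exps V} = edge_exps V E" (is "?L = _")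
  proof (intro equalityI subsetI)
    fix x assume "x \<in> ?L"
    then show "x \<in> edge_exps V E"
      using \<open>G \<subseteq> exps V\<close> by (fastforce simp: G_def edge_exps_def keys_add_nat)
  next
    fix x assume "x \<in> edge_exps V E"
    then obtain i j where x: "x \<in> exps V" "{i, j} \<in> E" "i \<in> Poly_Mapping.keys x" "j \<in> Poly_Mapping.keys x"
      by (auto simp: edge_exps_def)
    note split = two_step_split[OF simple_graph_edge(3)[OF assms x(2)] x(3,4)]
    then have "x - ?e i j \<in> exps V" using x(1) by (metis exps_add)
    moreover have "?e i j \<in> G" using x by (auto simp: G_def)
    ultimately show "x \<in> ?L" using split by blast
  qed
  ultimately show ?thesis
    unfolding edge_ideal_def * by (simp add: genideal_monomials)
qed

lemma square_exps_eq_sums: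
  assumes G: "simple_graph V E"
  shows "{a + b | a b. a \<in> edge_exps V E \<and> b \<in> edge_exps V E} = square_exps V E" (is "?L = _")
proof (intro equalityI subsetI)
  fix x assume "x \<in> ?L"
  then obtain a b where x: "x = a + b" and ab: "a \<in> exps V" "b \<in> exps V" and
     "\<exists>i j. {i, j} \<in> E \<and> i \<in> Poly_Mapping.keys a \<and> j \<in> Poly_Mapping.keys a"
     "\<exists>i j. {i, j} \<in> E \<and> i \<in> Poly_Mapping.keys b \<and> j \<in> Poly_Mapping.keys b"
    by (auto simp: edge_exps_def)
  then obtain i j k l where "{i, j} \<in> E" "{k, l} \<in> E" 
    "i \<in> Poly_Mapping.keys a" "j \<in> Poly_Mapping.keys a" "k \<in> Poly_Mapping.keys b" "l \<in> Poly_Mapping.keys b"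
    by blast
  then have "two_edges E (Poly_Mapping.lookup x)"
    by (intro two_edgesI[of i j E k l]) (auto simp: x lookup_add in_keys_iff)
  then show "x \<in> square_exps V E" using ab by (simp add: square_exps_def x)
next
  fix x assume x: "x \<in> square_exps V E"
  then obtain i j k l where e: "{i, j} \<in> E" "{k, l} \<in> E" and
    pos: "0 < Poly_Mapping.lookup x i" "0 < Poly_Mapping.lookup x j" "0 < Poly_Mapping.lookup x k" "0 < Poly_Mapping.lookup x l"
    "i \<in> {k, l} \<longrightarrow> 2 \<le> Poly_Mapping.lookup x i" "j \<in> {k, l} \<longrightarrow> 2 \<le> Poly_Mapping.lookup x j"
    unfolding square_exps_def two_edges_def by blast
  let ?e = "Poly_Mapping.single i 1 + Poly_Mapping.single j (1::nat)"
  have "i \<noteq> j" by (rule simple_graph_edge(3)[OF G e(1)])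
  have split: "x = ?e + (x - ?e)"
    by (rule two_step_split[OF \<open>i \<noteq> j\<close>]) (use pos in \<open>auto simp: in_keys_iff\<close>)
  have "x \<in> exps V" using x by (simp add: square_exps_def)
  then have V: "x - ?e \<in> exps V" "?e \<in> exps V" using split by (metis exps_add)+
  have "k \<in> Poly_Mapping.keys (x - ?e)" "l \<in> Poly_Mapping.keys (x - ?e)"
    using pos \<open>i \<noteq> j\<close> by (auto simp: in_keys_iff lookup_minus lookup_add lookup_single when_def)
  then have "x - ?e \<in> edge_exps V E" using V e by (auto simp: edge_exps_def)
  moreover have "?e \<in> edge_exps V E"
    using V(2) e(1) unfolding edge_exps_def by (simp add: keys_add_nat) blast
  ultimately show "x \<in> ?L" using split by blast
qed

lemma edge_ideal_square:
  assumes G: "simple_graph V E"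
  shows "ideal_power (poly_ring V) (edge_ideal V E) 2 = (polys_on (square_exps V E) :: (_ \<Rightarrow>\<^sub>0 'k::field) set)"
  using ideal_power_2_polys_on[OF monomial_set_edge_exps, of V E, where 'k='k]
  by (simp add: edge_ideal_eq[OF G] square_exps_eq_sums[OF G])

text \<open>
  Any two edges inside the support of \<open>a\<close>, equal or not, have to share a vertex of
  exponent \<open>1\<close>. Pairwise intersecting edges form a star or a triangle. In the triangle case an edge from the triangle to another vertex
  of the support would be disjoint from the opposite side of the triangle, so there is none.
\<close>

lemma not_two_edges_cases:
  assumes loopless: "\<forall>e\<in>E. card e = 2" and a: "\<not> two_edges E a"
  obtains (independent) "\<And>x y. {x, y} \<in> E \<Longrightarrow> a x = 0 \<or> a y = 0"
  | (star) i where "a i = 1" "\<And>x y. {x, y} \<in> E \<Longrightarrow> 0 < a x \<Longrightarrow> 0 < a y \<Longrightarrow> i = x \<or> i = y"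
  | (triangle) i j k where "three_cycle E {i, j, k}" "a i = 1" "a j = 1" "a k = 1"
      "\<And>x c. 0 < a x \<Longrightarrow> c \<in> {i, j, k} \<Longrightarrow> {x, c} \<in> E \<Longrightarrow> x \<in> {i, j, k}"
proof -
  have irrefl: "x \<noteq> y" if "{x, y} \<in> E" for x y
    using loopless that by force
  define L where "L x y \<longleftrightarrow> {x, y} \<in> E \<and> 0 < a x \<and> 0 < a y" for x y
  have sym: "L x y \<longleftrightarrow> L y x" for x y by (auto simp: L_def insert_commute)
  have Lne: "x \<noteq> y" if "L x y" for x y using that irrefl by (auto simp: L_def)
  have inter: "(i \<in> {k, l} \<and> a i = 1) \<or> (j \<in> {k, l} \<and> a j = 1)" if "L i j" "L k l" for i j k l
  proof (rule ccontr)
    assume "\<not> ?thesis"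
    then have "two_edges E a"
      using that by (intro two_edgesI[of i j E k l]) (auto simp: L_def)
    with a show False by simp
  qed
  consider "\<And>x y. \<not> L x y" | i j where "L i j" "a i = 1" "\<And>x y. L x y \<Longrightarrow> i \<in> {x, y}"
    | i j where "L i j" "\<not> (a i = 1 \<and> (\<forall>x y. L x y \<longrightarrow> i \<in> {x, y}))" "\<not> (a j = 1 \<and> (\<forall>x y. L x y \<longrightarrow> j \<in> {x, y}))"
    by (metis sym)
  then show thesis
  proof cases
    case 1
    then show thesis using independent by (auto simp: L_def)
  next
    case 2
    then show thesis using star[of i] by (auto simp: L_def)
  next
    case (3 i j)
    \<comment> \<open>If no endpoint of the edge from \<open>p\<close> to \<open>q\<close> is the centre of a star with exponent \<open>1\<close>, then some edge
      avoids \<open>p\<close>. It goes through \<open>q\<close>, as the two edges intersect.\<close>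
    have escape: "\<exists>y. L q y \<and> y \<noteq> p"
      if "L p q" "\<not> (a q = 1 \<and> (\<forall>x y. L x y \<longrightarrow> q \<in> {x, y}))"
        "\<not> (a p = 1 \<and> (\<forall>x y. L x y \<longrightarrow> p \<in> {x, y}))" for p q
    proof -
      have "\<exists>x y. L x y \<and> p \<notin> {x, y}"
      proof (rule ccontr)
        assume "\<not> ?thesis"
        then have "a p \<noteq> 1" using that(3) by blast
        then have "a q = 1 \<and> q \<in> {x, y}" if "L x y" for x y
          using inter[OF \<open>L p q\<close> that] by auto
        then show False using that(1,2) by blast
      qed
      then obtain x y where xy: "L x y" "p \<notin> {x, y}" by blast
      then have "q = x \<or> q = y" using inter[OF that(1) xy(1)] by auto
      then show ?thesis using xy sym by auto
    qed
    obtain k where k: "L j k" "k \<noteq> i" using escape[OF 3(1) 3(3,2)] by blast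
    obtain l where l: "L i l" "l \<noteq> j" using escape[of j i] 3 sym by blast
    have "i \<noteq> j" using 3(1) Lne by blast
    then have "k = l" using inter[OF k(1) l(1)] k(2) l(2) by auto
    then have k: "L i k" "L j k" using k l by auto
    note L = 3(1) k
    have ne: "i \<noteq> j" "i \<noteq> k" "j \<noteq> k" using L Lne by auto
    have "a i = 1" "a j = 1" "a k = 1"
      using inter[OF L(1,2)] inter[OF L(1,3)] inter[OF L(2,3)] ne by auto
    moreover have "three_cycle E {i, j, k}"
      unfolding three_cycle_def using L ne by (auto simp: L_def)
    moreover have "x \<in> {i, j, k}" if "0 < a x" "c \<in> {i, j, k}" "{x, c} \<in> E" for x c
    proof -
      have "L x c" using that L by (auto simp: L_def)
      then show ?thesis
        using that(2) inter[of x c i j] inter[of x c j k] inter[of x c i k] L ne by auto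
    qed
    ultimately show thesis using triangle by blast
  qed
qed

section \<open>Intersection type\<close>

text \<open>
  Each power of a monomial prime contributes one lower bound on a degree, by
  \<open>ideal_power_meets\<close>, and intersecting the powers imposes all the bounds.
\<close>

lemma intersection_type_polys_on:
  fixes V :: "'v::linorder set"
  assumes "finite V"
  shows "intersection_type V (polys_on M :: (_ \<Rightarrow>\<^sub>0 'k::field) set) \<longleftrightarrow>
    (\<exists>H. finite H \<and> H \<noteq> {} \<and> (\<forall>(A, k)\<in>H. A \<subseteq> V \<and> 0 < k) \<and>
       M = {a \<in> exps V. \<forall>(A, k)\<in>H. k \<le> (\<Sum>v\<in>A. Poly_Mapping.lookup a v)})"
proof
  let ?D = "\<lambda>A k. {a \<in> exps V. k \<le> (\<Sum>v\<in>A. Poly_Mapping.lookup a v)}"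
  note power = ideal_power_meets[OF _ finite_subset[OF _ assms], where 'k='k]
  {
    assume "intersection_type V (polys_on M :: (_ \<Rightarrow>\<^sub>0 'k) set)"
    then obtain F where F: "finite F" "F \<noteq> {}"
      and prime: "\<And>P k. (P, k) \<in> F \<Longrightarrow> monomial_prime V P \<and> 0 < k"
      and M: "(polys_on M :: (_ \<Rightarrow>\<^sub>0 'k) set) = (\<Inter>(P, k)\<in>F. ideal_power (poly_ring V) P k)"
      unfolding intersection_type_def by blast
    have "\<exists>A\<subseteq>V. fst x = polys_on (meets V A)" if "x \<in> F" for x
      using prime[of "fst x" "snd x"] that unfolding monomial_prime_def
      by (metis genideal_Var prod.collapse)
    then obtain \<alpha> where \<alpha>: "\<And>x. x \<in> F \<Longrightarrow> \<alpha> x \<subseteq> V \<and> fst x = polys_on (meets V (\<alpha> x))"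
      by metis
    define H where "H = (\<lambda>x. (\<alpha> x, snd x)) ` F"
    have "ideal_power (poly_ring V) (fst x) (snd x) = polys_on (?D (\<alpha> x) (snd x))" if "x \<in> F" for x
      using \<alpha>[OF that] power[where A="\<alpha> x" and k="snd x"] by simp
    then have "(polys_on M :: (_ \<Rightarrow>\<^sub>0 'k) set) = (\<Inter>x\<in>F. polys_on (?D (\<alpha> x) (snd x)))"
      unfolding M by (intro INF_cong) (auto simp: case_prod_beta)
    also have "\<dots> = polys_on (\<Inter>x\<in>F. ?D (\<alpha> x) (snd x))"
      by (auto simp: polys_on_def)
    finally have "M = (\<Inter>x\<in>F. ?D (\<alpha> x) (snd x))" by (simp only: polys_on_inject)
    also have "\<dots> = {a \<in> exps V. \<forall>(A, k)\<in>H. k \<le> (\<Sum>v\<in>A. Poly_Mapping.lookup a v)}"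
      using F(2) by (auto simp: H_def)
    finally have "M = \<dots>" .
    moreover have "finite H" "H \<noteq> {}" "\<forall>(A, k)\<in>H. A \<subseteq> V \<and> 0 < k"
      using F(1,2) \<alpha> prime[of "fst x" "snd x" for x] by (auto simp: H_def)
    ultimately show "\<exists>H. finite H \<and> H \<noteq> {} \<and> (\<forall>(A, k)\<in>H. A \<subseteq> V \<and> 0 < k) \<and>
       M = {a \<in> exps V. \<forall>(A, k)\<in>H. k \<le> (\<Sum>v\<in>A. Poly_Mapping.lookup a v)}" by blast
  next
    assume "\<exists>H. finite H \<and> H \<noteq> {} \<and> (\<forall>(A, k)\<in>H. A \<subseteq> V \<and> 0 < k) \<and>
       M = {a \<in> exps V. \<forall>(A, k)\<in>H. k \<le> (\<Sum>v\<in>A. Poly_Mapping.lookup a v)}"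
    then obtain H where H: "finite H" "H \<noteq> {}" "\<And>A k. (A, k) \<in> H \<Longrightarrow> A \<subseteq> V \<and> 0 < k"
      and M: "M = {a \<in> exps V. \<forall>(A, k)\<in>H. k \<le> (\<Sum>v\<in>A. Poly_Mapping.lookup a v)}"
      by blast
    define F where "F = (\<lambda>(A, k). (polys_on (meets V A) :: (_ \<Rightarrow>\<^sub>0 'k) set, k)) ` H"
    have "(\<Inter>(P, k)\<in>F. ideal_power (poly_ring V) P k)
        = (\<Inter>(A, k)\<in>H. ideal_power (poly_ring V) (polys_on (meets V A) :: (_ \<Rightarrow>\<^sub>0 'k) set) k)"
      by (auto simp: F_def)
    also have "\<dots> = (\<Inter>(A, k)\<in>H. polys_on (?D A k))"
      using H(3) power by (intro INF_cong) auto
    also have "\<dots> = polys_on M"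
      using H(2) unfolding M polys_on_def by auto
    finally have "(\<Inter>(P, k)\<in>F. ideal_power (poly_ring V) P k) = polys_on M" .
    moreover have "monomial_prime V P \<and> 0 < k" if "(P, k) \<in> F" for P k
    proof -
      obtain A where "(A, k) \<in> H" "P = polys_on (meets V A)" using \<open>(P, k) \<in> F\<close> by (auto simp: F_def)
      then show ?thesis
        using H(3)[of A k] genideal_Var[of A V, where 'k='k] primeideal_meets[of V A, where 'k='k]
        by (auto simp: monomial_prime_def)
    qed
    moreover have "finite F" "F \<noteq> {}" using H(1,2) by (auto simp: F_def)
    ultimately show "intersection_type V (polys_on M :: (_ \<Rightarrow>\<^sub>0 'k) set)"
      unfolding intersection_type_def by (intro exI[of _ F]) auto
  }
qed

lemma sum_lookup_single: "finite A \<Longrightarrow> (\<Sum>x\<in>A. Poly_Mapping.lookup (Poly_Mapping.single v (n::nat)) x) = (if v \<in> A then n else 0)"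
  by (simp add: lookup_single when_def)

text \<open>
  An edge from \<open>v\<close> to a corner of a triangle is disjoint from, or at \<open>v\<close>
  compatible with, the side opposite to that corner.
\<close>

lemma two_edges_triangle_plus:
  assumes "{i, j} \<in> E" "{j, k} \<in> E" "{i, k} \<in> E" "i \<noteq> j" "j \<noteq> k" "i \<noteq> k"
    and "{v, c} \<in> E" "c \<in> {i, j, k}" "v \<noteq> c" 
    and "1 \<le> a i" "1 \<le> a j" "1 \<le> a k" "1 \<le> a v" "v \<in> {i, j, k} \<Longrightarrow> 2 \<le> a v"
  shows "two_edges E a"
proof -
  have two: "2 \<le> a v" if "v = i \<or> v = j \<or> v = k" using that assms(14) by blast
  note pos = assms(10-13)
  consider "c = i" | "c = j" | "c = k" using assms(8) by blast
  then show ?thesis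
  proof cases
    case 1
    have "{v, i} \<in> E" using assms(7) 1 by simp
    from this assms(2) show ?thesis by (rule two_edgesI) (use pos two assms(4-6) in auto)
  next
    case 2
    have "{v, j} \<in> E" using assms(7) 2 by simp
    from this assms(3) show ?thesis by (rule two_edgesI) (use pos two assms(4-6) in auto)
  next
    case 3
    have "{v, k} \<in> E" using assms(7) 3 by simp
    from this assms(1) show ?thesis by (rule two_edgesI) (use pos two assms(4-6) in auto)
  qed
qed

text \<open>
  Two edges inside a set of vertices of exponent \<open>1\<close> have to be disjoint, and therefore
  need four vertices.
\<close>

lemma not_two_edges_in_triangle:
  assumes loopless: "\<forall>e\<in>E. card e = 2"
    and C: "finite C" "card C \<le> 3" "\<And>c. c \<in> C \<Longrightarrow> a c = 1"
    and inside: "\<And>p q. {p, q} \<in> E \<Longrightarrow> 0 < a p \<Longrightarrow> 0 < a q \<Longrightarrow> p \<in> C"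
  shows "\<not> two_edges E a"
proof
  assume "two_edges E a"
  then obtain i j k l where e: "{i, j} \<in> E" "{k, l} \<in> E"
    and pos: "0 < a i" "0 < a j" "0 < a k" "0 < a l"
    and two: "i \<in> {k, l} \<longrightarrow> 2 \<le> a i" "j \<in> {k, l} \<longrightarrow> 2 \<le> a j"
    unfolding two_edges_def by blast
  have "{j, i} \<in> E" "{l, k} \<in> E" using e by (simp_all add: insert_commute)
  then have "{i, j, k, l} \<subseteq> C" using inside e pos by blast
  moreover have "i \<noteq> j" "k \<noteq> l" using e loopless by force+
  moreover have "i \<notin> {k, l}" "j \<notin> {k, l}"
    using two C(3)[of i] C(3)[of j] calculation(1) by auto
  ultimately have "card {i, j, k, l} = 4" by auto
  moreover have "card {i, j, k, l} \<le> card C"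
    using C(1) \<open>{i, j, k, l} \<subseteq> C\<close> by (rule card_mono)
  ultimately show False using C(2) by simp
qed

text \<open>
  From left to right: let \<open>v\<close> be adjacent to no corner of a triangle \<open>C\<close>, and
  let \<open>a\<close> be \<open>1\<close> on \<open>C\<close> and large at \<open>v\<close>. This vector has
  no two edges, so it violates some bound \<open>(A, k)\<close>. As its exponent at \<open>v\<close> is
  large, \<open>v \<notin> A\<close>; as raising the exponent at a corner creates two edges, \<open>C \<subseteq> A\<close>.
  Therefore \<open>k \<ge> 4\<close>, which fails for the square of an edge at \<open>v\<close>.

  From right to left: the bounds are degree at least \<open>2\<close> on every vertex cover and degree at
  least \<open>4\<close> on all vertices. By the classification \<open>not_two_edges_cases\<close>, a vector without two edges has
  degree at most \<open>1\<close> on some vertex cover, unless its support contains a triangle. In that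
  case centrality forces the support to be the triangle, and the degree is \<open>3\<close>.
\<close>

lemma intersection_type_square_exps_iff:
  assumes G: "simple_graph V E" and iso: "no_isolated_vertices V E"
  shows "(\<exists>H. finite H \<and> H \<noteq> {} \<and> (\<forall>(A, k)\<in>H. A \<subseteq> V \<and> 0 < k) \<and>
       square_exps V E = {a \<in> exps V. \<forall>(A, k)\<in>H. k \<le> (\<Sum>v\<in>A. Poly_Mapping.lookup a v)})
     \<longleftrightarrow> (\<forall>C. three_cycle E C \<longrightarrow> central V E C)" (is "?L \<longleftrightarrow> ?R")
proof
  have fin: "finite V" and loopless: "\<forall>e\<in>E. card e = 2" using G by (auto simp: simple_graph_def)
  note edge = simple_graph_edge[OF G]
  {
    assume ?L
    then obtain H where H1: "finite H" "\<forall>(A, k)\<in>H. A \<subseteq> V \<and> 0 < k"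
      and eq: "square_exps V E = {a \<in> exps V. \<forall>(A, k)\<in>H. k \<le> (\<Sum>v\<in>A. Poly_Mapping.lookup a v)}"
      by (elim exE conjE)
    have H: "finite H" "\<And>A k. (A, k) \<in> H \<Longrightarrow> A \<subseteq> V" using H1 by auto
    show ?R
    proof (intro allI impI)
      fix C assume "three_cycle E C"
      then obtain x y z where C: "C = {x, y, z}" and ne: "x \<noteq> y" "y \<noteq> z" "x \<noteq> z"
        and E: "{x, y} \<in> E" "{y, z} \<in> E" "{x, z} \<in> E" unfolding three_cycle_def by blast
      show "central V E C"
      proof (rule ccontr)
        assume "\<not> central V E C"
        then obtain v where v: "v \<in> V" "\<And>c. c \<in> C \<Longrightarrow> {v, c} \<notin> E" unfolding central_def by blast
        have "v \<noteq> x" "v \<noteq> y" "v \<noteq> z" using v(2)[of x] v(2)[of y] E by (auto simp: C insert_commute)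
        then have vC: "v \<notin> C" by (simp add: C)
        obtain w where w: "{v, w} \<in> E" using iso v(1) unfolding no_isolated_vertices_def by blast
        let ?s = "Poly_Mapping.single :: _ \<Rightarrow> nat \<Rightarrow> _"
        \<comment> \<open>\<open>N\<close> exceeds every bound in \<open>H\<close>, so a violated bound cannot involve \<open>v\<close>.\<close>
        define N where "N = Suc (\<Sum>x\<in>H. snd x)"
        have N: "k < N" if "(A, k) \<in> H" for A k
          using member_le_sum[of "(A, k)" H snd] that H(1) by (simp add: N_def)
        define a where "a = ?s x 1 + ?s y 1 + ?s z 1 + ?s v N"
        have la: "Poly_Mapping.lookup a u = (if u = v then N else if u \<in> C then 1 else 0)" for u
          using vC ne by (auto simp: a_def C lookup_add lookup_single when_def)
        have VC: "x \<in> V" "y \<in> V" "z \<in> V" using E edge by blast+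
        have aV: "a \<in> exps V" using v(1) VC by (simp add: a_def N_def)
        have "p \<in> C" if e: "{p, q} \<in> E" and "0 < Poly_Mapping.lookup a p" "0 < Poly_Mapping.lookup a q" for p q
        proof -
          have "p \<in> insert v C" "q \<in> insert v C"
            using that(2,3) by (simp_all add: la split: if_splits)
          then show ?thesis using v(2) e edge(3)[OF e] by auto
        qed
        then have "\<not> two_edges E (Poly_Mapping.lookup a)"
          using vC by (intro not_two_edges_in_triangle[OF loopless, of C])
            (auto simp: la C card_insert_if)
        then have "a \<notin> square_exps V E" by (simp add: square_exps_def)
        then obtain A k where A: "(A, k) \<in> H" and less: "(\<Sum>u\<in>A. Poly_Mapping.lookup a u) < k"
          unfolding eq using aV by (auto simp: not_le)
        have finA: "finite A" using H(2)[OF A] fin finite_subset by blast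
        have "v \<notin> A"
        proof
          assume "v \<in> A"
          then have "Poly_Mapping.lookup a v \<le> (\<Sum>u\<in>A. Poly_Mapping.lookup a u)"
            using finA by (intro member_le_sum) auto
          then show False using less N[OF A] by (simp add: la)
        qed
        have CA: "c \<in> A" if c: "c \<in> C" for c
        proof (rule ccontr)
          assume "c \<notin> A"
          obtain d where d: "{c, d} \<in> E" "d \<in> C" using c E by (auto simp: C insert_commute)
          have "two_edges E (Poly_Mapping.lookup (a + ?s c 1))"
            by (rule two_edges_triangle_plus[OF E(1,2,3) ne d(1) _ edge(3)[OF d(1)]])
               (use c d vC ne in \<open>auto simp: lookup_add la C lookup_single when_def\<close>)
          then have "a + ?s c 1 \<in> square_exps V E"
            using aV VC c by (auto simp: square_exps_def C)
          then have "k \<le> (\<Sum>u\<in>A. Poly_Mapping.lookup (a + ?s c 1) u)"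
            unfolding eq using A by blast
          also have "\<dots> = (\<Sum>u\<in>A. Poly_Mapping.lookup a u)"
            using finA \<open>c \<notin> A\<close> by (simp add: lookup_add sum.distrib sum_lookup_single)
          finally show False using less by simp
        qed
        have "card C = 3" using ne by (simp add: C)
        have "(\<Sum>u\<in>C. Poly_Mapping.lookup a u) = (\<Sum>u\<in>C. 1)"
          using vC by (intro sum.cong) (auto simp: la)
        then have "3 = (\<Sum>u\<in>C. Poly_Mapping.lookup a u)" using \<open>card C = 3\<close> by simp
        also have "\<dots> \<le> (\<Sum>u\<in>A. Poly_Mapping.lookup a u)"
          using CA finA by (intro sum_mono2) auto
        finally have "4 \<le> k" using less by simp
        let ?b = "?s v 2 + ?s w 2"
        have "v \<noteq> w" "w \<in> V" using edge[OF w] by auto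
        then have "?b \<in> square_exps V E"
          using v(1) w unfolding square_exps_def
          by (auto simp: exps_def keys_add_nat lookup_add lookup_single intro!: two_edgesI[of v w E v w])
        then have "k \<le> (\<Sum>u\<in>A. Poly_Mapping.lookup ?b u)" unfolding eq using A by blast
        also have "\<dots> \<le> 2" using finA \<open>v \<notin> A\<close> by (simp add: lookup_add sum.distrib sum_lookup_single)
        finally show False using \<open>4 \<le> k\<close> by simp
      qed
    qed
  next
    assume central: ?R
    define H where "H = insert (V, 4) ((\<lambda>A. (A, 2::nat)) ` {A. A \<subseteq> V \<and> (\<forall>e\<in>E. e \<inter> A \<noteq> {})})"
    have "square_exps V E = {a \<in> exps V. \<forall>(A, k)\<in>H. k \<le> (\<Sum>v\<in>A. Poly_Mapping.lookup a v)}"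
      (is "_ = ?D")
    proof (intro equalityI subsetI)
      fix a assume a: "a \<in> square_exps V E"
      then have aV: "a \<in> exps V" by (simp add: square_exps_def)
      let ?deg = "\<lambda>a A. \<Sum>v\<in>A. Poly_Mapping.lookup a v"
      have "a \<in> {b + c | b c. b \<in> edge_exps V E \<and> c \<in> edge_exps V E}"
        using a by (simp add: square_exps_eq_sums[OF G])
      then obtain b c where bc: "a = b + c" "b \<in> edge_exps V E" "c \<in> edge_exps V E" by blast
      have cover: "1 \<le> ?deg b A" if A: "A \<subseteq> V" "\<forall>e\<in>E. e \<inter> A \<noteq> {}" and b: "b \<in> edge_exps V E" for A b
      proof -
        obtain i j where ij: "{i, j} \<in> E" "i \<in> Poly_Mapping.keys b" "j \<in> Poly_Mapping.keys b"
          using b unfolding edge_exps_def by blast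
        have "{i, j} \<inter> A \<noteq> {}" using A(2) ij(1) by (rule bspec)
        then obtain v where "v \<in> A" "v \<in> Poly_Mapping.keys b" using ij(2,3) by auto
        then show ?thesis
          using member_le_sum[of v A "Poly_Mapping.lookup b"] finite_subset[OF A(1) fin]
          by (auto simp: in_keys_iff)
      qed
      have deg: "2 \<le> ?deg b V" if b: "b \<in> edge_exps V E" for b
      proof -
        obtain i j where ij: "{i, j} \<in> E" "i \<in> Poly_Mapping.keys b" "j \<in> Poly_Mapping.keys b"
          using b by (auto simp: edge_exps_def)
        have "2 \<le> ?deg b {i, j}" using ij edge(3)[OF ij(1)] by (simp add: in_keys_iff)
        also have "\<dots> \<le> ?deg b V" using edge[OF ij(1)] fin by (intro sum_mono2) auto
        finally show ?thesis .
      qed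
      have "2 \<le> ?deg a A" if "A \<subseteq> V" "\<forall>e\<in>E. e \<inter> A \<noteq> {}" for A
        using cover[OF that bc(2)] cover[OF that bc(3)] by (simp add: bc(1) lookup_add sum.distrib)
      moreover have "4 \<le> ?deg a V"
        using deg[OF bc(2)] deg[OF bc(3)] by (simp add: bc(1) lookup_add sum.distrib)
      ultimately show "a \<in> ?D" using aV by (auto simp: H_def)
    next
      fix a assume a: "a \<in> ?D"
      then have aV: "a \<in> exps V" by simp
      have deg: "4 \<le> (\<Sum>v\<in>V. Poly_Mapping.lookup a v)"
        and cover: "\<And>A. A \<subseteq> V \<Longrightarrow> \<forall>e\<in>E. e \<inter> A \<noteq> {} \<Longrightarrow> 2 \<le> (\<Sum>v\<in>A. Poly_Mapping.lookup a v)"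
        using a by (auto simp: H_def)
      show "a \<in> square_exps V E"
      proof (rule ccontr)
        assume "a \<notin> square_exps V E"
        then have not: "\<not> two_edges E (Poly_Mapping.lookup a)" using aV by (simp add: square_exps_def)
        have large_cover: False if small: "(\<Sum>v\<in>A. Poly_Mapping.lookup a v) < 2" and A: "A \<subseteq> V"
            and ind: "\<And>x y. {x, y} \<in> E \<Longrightarrow> x \<in> A \<or> y \<in> A" for A
        proof -
          have "\<forall>e\<in>E. e \<inter> A \<noteq> {}"
          proof
            fix e assume "e \<in> E"
            then obtain x y where "e = {x, y}" using loopless by (metis card_2_iff)
            then show "e \<inter> A \<noteq> {}" using ind \<open>e \<in> E\<close> by auto
          qed
          from cover[OF A this] small show False by simp
        qed
        show False
        proof (cases rule: not_two_edges_cases[OF loopless not])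
          case 1
          show False
            by (rule large_cover[of "{v \<in> V. Poly_Mapping.lookup a v = 0}"]) (use 1 edge in auto)
        next
          case (2 i)
          let ?A = "{v \<in> V. Poly_Mapping.lookup a v = 0 \<or> v = i}"
          have "(\<Sum>v\<in>?A. Poly_Mapping.lookup a v) \<le> (\<Sum>v\<in>?A. if v = i then 1 else 0)"
            using 2(1) by (intro sum_mono) auto
          also have "\<dots> \<le> 1" using fin by (simp add: sum.delta)
          finally have small: "(\<Sum>v\<in>?A. Poly_Mapping.lookup a v) < 2" by simp
          have "x \<in> ?A \<or> y \<in> ?A" if "{x, y} \<in> E" for x y
            using 2(2)[OF that] edge[OF that] by auto
          with small show False by (intro large_cover[of ?A]) auto
        next
          case (3 i j k)
          have "Poly_Mapping.lookup a v = 0" if v: "v \<in> V - {i, j, k}" for v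
          proof (rule ccontr)
            assume "Poly_Mapping.lookup a v \<noteq> 0"
            moreover obtain c where "c \<in> {i, j, k}" "{v, c} \<in> E"
              using central 3(1) v unfolding central_def by blast
            ultimately show False using 3(5)[of v c] v by auto
          qed
          then have "(\<Sum>v\<in>V. Poly_Mapping.lookup a v) = (\<Sum>v\<in>V \<inter> {i, j, k}. Poly_Mapping.lookup a v)"
            by (intro sum.mono_neutral_right) (use fin in auto)
          also have "\<dots> = card (V \<inter> {i, j, k})"
            using 3(2-4) by (subst card_eq_sum, intro sum.cong) auto
          also have "\<dots> \<le> card {i, j, k}" by (intro card_mono) auto
          also have "\<dots> \<le> 3" by (simp add: card_insert_if)
          finally show False using deg by simp
        qed
      qed
    qed
    moreover have "finite H" "H \<noteq> {}" "\<forall>(A, k)\<in>H. A \<subseteq> V \<and> 0 < k"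
      using fin by (auto simp: H_def)
    ultimately show ?L by blast
  }
qed

section \<open>Associated primes of the square\<close>

text \<open>
  By \<open>Ass_quot_polys_on\<close>, the prime generated by the variables from \<open>A\<close> is an
  associated prime of the monomial ideal with exponents \<open>M\<close>.
\<close>

definition associated :: "'v set \<Rightarrow> ('v \<Rightarrow>\<^sub>0 nat) set \<Rightarrow> 'v set \<Rightarrow> bool" where
  "associated V M A \<longleftrightarrow>
     (\<exists>a\<in>exps V. \<forall>c\<in>exps V. a + c \<in> M \<longleftrightarrow> Poly_Mapping.keys c \<inter> A \<noteq> {})"

lemma obtain_indicator:
  assumes "finite W"
  obtains s where "\<And>v. Poly_Mapping.lookup s v = (if v \<in> W then n else (0::nat))"
  using assms by (intro that[of "Abs_poly_mapping (\<lambda>v. if v \<in> W then n else 0)"]) simp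

text \<open>
  The hypotheses say that \<open>V - A\<close> is a maximal independent set; the product of its
  variables is the required monomial.
\<close>

lemma associated_edge_expsI:
  assumes G: "simple_graph V E" and "A \<subseteq> V"
    and cover: "\<And>x y. {x, y} \<in> E \<Longrightarrow> x \<in> A \<or> y \<in> A"
    and neighbour: "\<And>v. v \<in> A \<Longrightarrow> \<exists>w\<in>V - A. {v, w} \<in> E"
  shows "associated V (edge_exps V E) A"
proof -
  have "finite V" using G by (simp add: simple_graph_def)
  then obtain a where a: "\<And>v. Poly_Mapping.lookup a v = (if v \<in> V - A then 1 else (0::nat))"
    using obtain_indicator[of "V - A" 1] by blast
  have keys: "Poly_Mapping.keys a = V - A" by (auto simp: in_keys_iff a split: if_splits)
  have "a + c \<in> edge_exps V E \<longleftrightarrow> Poly_Mapping.keys c \<inter> A \<noteq> {}" if c: "c \<in> exps V" for c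
  proof
    assume "a + c \<in> edge_exps V E"
    then obtain i j where "{i, j} \<in> E" "i \<in> (V - A) \<union> Poly_Mapping.keys c" "j \<in> (V - A) \<union> Poly_Mapping.keys c"
      by (auto simp: edge_exps_def keys_add_nat keys)
    then show "Poly_Mapping.keys c \<inter> A \<noteq> {}" using cover[of i j] by auto
  next
    assume "Poly_Mapping.keys c \<inter> A \<noteq> {}"
    then obtain v where v: "v \<in> Poly_Mapping.keys c" "v \<in> A" by blast
    then obtain w where "w \<in> V - A" "{v, w} \<in> E" using neighbour by blast
    then show "a + c \<in> edge_exps V E"
      using v c keys by (simp add: edge_exps_def keys_add_nat) (auto simp: exps_def)
  qed
  moreover have "a \<in> exps V" by (auto simp: exps_def keys)
  ultimately show ?thesis unfolding associated_def by blast
qed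

text \<open>
  Let the monomial \<open>a0\<close> have the prime of \<open>A\<close> as its annihilator. Multiplication
  by squares of variables outside \<open>A\<close> does not change the annihilator, so every vertex outside
  \<open>A\<close> may be given exponent at least \<open>2\<close>. The resulting vector \<open>a\<close> has no
  two edges, whereas raising any exponent in \<open>A\<close> creates two edges. In particular
  \<open>V - A\<close> is independent; if it is nonempty, its maximality has to be shown.

  If the support of \<open>a\<close> is independent, then raising one exponent cannot create two edges,
  so \<open>A\<close> is empty. If it is a star with centre \<open>i\<close>, then every \<open>v \<in> A\<close>
  has a neighbour \<open>x \<noteq> i\<close> in the support. Such an \<open>x\<close> is outside
  \<open>A\<close>, for otherwise it would in turn have a neighbour in the support other than
  \<open>i\<close>. If it contains a triangle, then a vertex outside \<open>A\<close> would lie in the support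
  with exponent \<open>2\<close>, hence not be adjacent to the triangle, contrary to centrality.
\<close>

lemma associated_square_exps_central:
  assumes G: "simple_graph V E" and A: "A \<subseteq> V" and assoc: "associated V (square_exps V E) A"
    and central: "\<forall>C. three_cycle E C \<longrightarrow> central V E C"
  shows "A = V \<or> associated V (edge_exps V E) A"
proof -
  have fin: "finite V" and loopless: "\<forall>e\<in>E. card e = 2" using G by (auto simp: simple_graph_def)
  note edge = simple_graph_edge[OF G]
  obtain a0 where a0: "a0 \<in> exps V"
    and iff0: "\<And>c. c \<in> exps V \<Longrightarrow> a0 + c \<in> square_exps V E \<longleftrightarrow> Poly_Mapping.keys c \<inter> A \<noteq> {}"
    using assoc unfolding associated_def by blast
  obtain s where s: "\<And>v. Poly_Mapping.lookup s v = (if v \<in> V - A then 2 else (0::nat))"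
    using obtain_indicator[of "V - A" 2] fin by blast
  have keys_s: "Poly_Mapping.keys s = V - A" by (auto simp: in_keys_iff s split: if_splits)
  define a where "a = Poly_Mapping.lookup (a0 + s)"
  have large: "2 \<le> a w" if "w \<in> V - A" for w using that by (simp add: a_def lookup_add s)
  have sV: "s \<in> exps V" by (auto simp: exps_def keys_s)
  have not: "\<not> two_edges E a"
    using iff0[OF sV] a0 sV unfolding a_def by (auto simp: keys_s square_exps_def)
  have step: "two_edges E (\<lambda>x. a x + (if x = v then 1 else 0))" if "v \<in> A" for v
  proof -
    let ?e = "Poly_Mapping.single v (1::nat)"
    have "s + ?e \<in> exps V" using sV that A by auto
    then have "a0 + (s + ?e) \<in> square_exps V E"
      using iff0 that by (simp add: keys_add_nat)
    moreover have "Poly_Mapping.lookup (a0 + (s + ?e)) = (\<lambda>x. a x + (if x = v then 1 else 0))"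
      by (auto simp: a_def lookup_add lookup_single when_def)
    ultimately show ?thesis by (simp add: square_exps_def)
  qed
  have cover: "x \<in> A \<or> y \<in> A" if e: "{x, y} \<in> E" for x y
  proof (rule ccontr)
    assume "\<not> ?thesis"
    then have "2 \<le> a x" "2 \<le> a y" using edge[OF e] by (auto intro: large)
    then have "two_edges E a" using e by (intro two_edgesI[of x y E x y]) auto
    with not show False by simp
  qed
  show ?thesis
  proof (cases rule: not_two_edges_cases[OF loopless not])
    case 1
    have "A = {}"
    proof (rule ccontr)
      assume "A \<noteq> {}"
      then obtain v where "v \<in> A" by blast
      from step[OF this] obtain i j k l where e: "{i, j} \<in> E" "{k, l} \<in> E"
        and pos: "0 < a i + (if i = v then 1 else 0)" "0 < a j + (if j = v then 1 else 0)"
          "0 < a k + (if k = v then 1 else 0)" "0 < a l + (if l = v then 1 else 0)"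
        and two: "i \<in> {k, l} \<longrightarrow> 2 \<le> a i + (if i = v then 1 else 0)"
          "j \<in> {k, l} \<longrightarrow> 2 \<le> a j + (if j = v then 1 else 0)"
        by (rule two_edgesE)
      have "v \<in> {i, j} \<and> a v = 0" "v \<in> {k, l}"
        using 1[OF e(1)] 1[OF e(2)] pos by (auto split: if_splits)
      then show False using two by auto
    qed
    then show ?thesis using associated_edge_expsI[OF G A cover] by blast
  next
    case (2 i)
    have outside: "\<exists>x. {v, x} \<in> E \<and> 0 < a x \<and> x \<noteq> i" if v: "v \<in> A" for v
    proof (cases "v = i")
      case True
      from step[OF v] obtain p q where e: "{p, q} \<in> E"
        and "0 < a p + (if p = v then 1 else 0)" "0 < a q + (if q = v then 1 else 0)"
        by (rule two_edgesE)
      then have pq: "0 < a p" "0 < a q" using True 2(1) by (auto split: if_splits)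
      have "p \<noteq> q" by (rule edge(3)[OF e])
      then show ?thesis
        using 2(2)[OF e pq] e pq True by (auto simp: insert_commute)
    next
      case False
      \<comment> \<open>An edge that avoids \<open>i\<close> is not inside the support, so it goes through \<open>v\<close>.\<close>
      have new: "\<exists>x. {v, x} \<in> E \<and> 0 < a x \<and> x \<noteq> i"
        if e: "{p, q} \<in> E" "i \<notin> {p, q}"
          and pos: "0 < a p + (if p = v then 1 else 0)" "0 < a q + (if q = v then 1 else 0)" for p q
      proof -
        have "p \<noteq> q" by (rule edge(3)[OF e(1)])
        moreover have "p = v \<or> q = v"
          using 2(2)[OF e(1)] e(2) pos by (auto split: if_splits)
        ultimately show ?thesis using e pos by (auto simp: insert_commute)
      qed
      from step[OF v] obtain p q k l where e: "{p, q} \<in> E" "{k, l} \<in> E"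
        and pos: "0 < a p + (if p = v then 1 else 0)" "0 < a q + (if q = v then 1 else 0)"
          "0 < a k + (if k = v then 1 else 0)" "0 < a l + (if l = v then 1 else 0)"
        and two: "p \<in> {k, l} \<longrightarrow> 2 \<le> a p + (if p = v then 1 else 0)"
          "q \<in> {k, l} \<longrightarrow> 2 \<le> a q + (if q = v then 1 else 0)"
        by (rule two_edgesE)
      \<comment> \<open>The exponent \<open>1\<close> of \<open>i\<close> does not suffice for both edges.\<close>
      have "i \<notin> {p, q} \<or> i \<notin> {k, l}"
        using two False 2(1) by auto
      then show ?thesis
        using new[OF e(1) _ pos(1,2)] new[OF e(2) _ pos(3,4)] by blast
    qed
    have "\<exists>w\<in>V - A. {v, w} \<in> E" if v: "v \<in> A" for v
    proof -
      obtain x where x: "{v, x} \<in> E" "0 < a x" "x \<noteq> i" using outside[OF v] by blast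
      have "x \<notin> A"
      proof
        assume "x \<in> A"
        then obtain y where y: "{x, y} \<in> E" "0 < a y" "y \<noteq> i" using outside by blast
        then show False using 2(2)[OF y(1)] x by auto
      qed
      then show ?thesis using x(1) edge[OF x(1)] by blast
    qed
    then show ?thesis using associated_edge_expsI[OF G A cover] by blast
  next
    case (3 i j k)
    have "V \<subseteq> A"
    proof
      fix w assume w: "w \<in> V"
      show "w \<in> A"
      proof (rule ccontr)
        assume "w \<notin> A"
        then have "2 \<le> a w" using w by (intro large) simp
        moreover obtain c where "c \<in> {i, j, k}" "{w, c} \<in> E"
          using central 3(1) w unfolding central_def by blast
        ultimately show False using 3(5)[of w c] 3(2-4) by auto
      qed
    qed
    then show ?thesis using A by blast
  qed
qed

text \<open>
  Let \<open>N\<close> be the set of neighbours of the triangle \<open>C\<close>, which contains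
  \<open>C\<close>, and let \<open>W\<close> be a maximal independent set in \<open>V - N\<close>. The product
  of the variables in \<open>C \<union> W\<close> has the prime of \<open>V - W\<close> as its annihilator modulo
  the square of the edge ideal: a vertex of \<open>N\<close> yields an edge to \<open>C\<close> next to the
  opposite side of \<open>C\<close>, any other vertex outside \<open>W\<close> an edge to \<open>W\<close>,
  and the vertices of \<open>W\<close> yield no edge at all. The prime is not associated to the edge
  ideal, as that would make \<open>V - W\<close> a minimal vertex cover, while a corner of \<open>C\<close> can
  be removed from it.
\<close>

lemma noncentral_associated:
  assumes G: "simple_graph V E" and cycle: "three_cycle E C" and noncentral: "\<not> central V E C"
  obtains A where "A \<subseteq> V" "A \<noteq> V" "associated V (square_exps V E) A" "\<not> associated V (edge_exps V E) A"
proof -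
  have fin: "finite V" and loopless: "\<forall>e\<in>E. card e = 2" using G by (auto simp: simple_graph_def)
  note edge = simple_graph_edge[OF G]
  obtain x y z where C: "C = {x, y, z}" and ne: "x \<noteq> y" "y \<noteq> z" "x \<noteq> z"
    and E: "{x, y} \<in> E" "{y, z} \<in> E" "{x, z} \<in> E"
    using cycle unfolding three_cycle_def by blast
  obtain v0 where v0: "v0 \<in> V" "\<And>c. c \<in> C \<Longrightarrow> {v0, c} \<notin> E"
    using noncentral unfolding central_def by blast
  define N where "N = {v \<in> V. \<exists>c\<in>C. {v, c} \<in> E}"
  have CN: "C \<subseteq> N" using E edge by (auto simp: N_def C insert_commute)
  define F where "F = {W. W \<subseteq> V - N \<and> (\<forall>p\<in>W. \<forall>q\<in>W. {p, q} \<notin> E)}"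
  have "{v0} \<in> F" using v0 edge(3)[of v0 v0] by (auto simp: F_def N_def)
  moreover have "finite F" using fin by (auto simp: F_def intro!: finite_subset[of F "Pow V"])
  ultimately obtain W where W: "W \<in> F" "v0 \<in> W" and max: "\<And>W'. W' \<in> F \<Longrightarrow> W \<subseteq> W' \<Longrightarrow> W = W'"
    using finite_has_maximal2[of F "{v0}"] by auto
  have WV: "W \<subseteq> V" "W \<inter> N = {}" and ind: "\<And>p q. p \<in> W \<Longrightarrow> q \<in> W \<Longrightarrow> {p, q} \<notin> E"
    using W(1) by (auto simp: F_def)
  have WC: "W \<inter> C = {}" using CN WV by blast
  have WCE: "{p, c} \<notin> E" if "p \<in> W" "c \<in> C" for p c
    using WV that by (auto simp: N_def)
  have dom: "\<exists>w\<in>W. {v, w} \<in> E" if v: "v \<in> V" "v \<notin> N" "v \<notin> W" for v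
  proof (rule ccontr)
    assume no: "\<not> ?thesis"
    then have "insert v W \<in> F"
      using v W(1) edge(3)[of v v] by (auto simp: F_def insert_commute)
    then have "W = insert v W" by (intro max) auto
    with v(3) show False by blast
  qed
  let ?A = "V - W"
  have finWC: "finite (W \<union> C)" using WV(1) fin by (auto simp: C intro: finite_subset)
  obtain a where a: "\<And>v. Poly_Mapping.lookup a v = (if v \<in> W \<union> C then 1 else (0::nat))"
    using obtain_indicator[OF finWC, of 1] by blast
  have keys_a: "Poly_Mapping.keys a = W \<union> C" by (auto simp: in_keys_iff a split: if_splits)
  have "N \<subseteq> V" by (auto simp: N_def)
  then have aV: "a \<in> exps V" using WV(1) CN by (auto simp: exps_def keys_a)
  have "a + c \<in> square_exps V E \<longleftrightarrow> Poly_Mapping.keys c \<inter> ?A \<noteq> {}" if c: "c \<in> exps V" for c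
  proof
    assume sq: "a + c \<in> square_exps V E"
    show "Poly_Mapping.keys c \<inter> ?A \<noteq> {}"
    proof
      assume "Poly_Mapping.keys c \<inter> ?A = {}"
      then have cW: "Poly_Mapping.keys c \<subseteq> W" using c by (auto simp: exps_def)
      have "\<not> two_edges E (Poly_Mapping.lookup (a + c))"
      proof (rule not_two_edges_in_triangle[OF loopless, of C])
        show "finite C" "card C \<le> 3" by (auto simp: C card_insert_if)
        fix p assume "p \<in> C"
        then have "p \<notin> Poly_Mapping.keys c" using cW WC by blast
        then show "Poly_Mapping.lookup (a + c) p = 1"
          using \<open>p \<in> C\<close> by (simp add: lookup_add a in_keys_iff)
      next
        fix p q assume e: "{p, q} \<in> E" and "0 < Poly_Mapping.lookup (a + c) p" "0 < Poly_Mapping.lookup (a + c) q"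
        then have "p \<in> Poly_Mapping.keys (a + c)" "q \<in> Poly_Mapping.keys (a + c)"
          by (auto simp: in_keys_iff)
        then have "p \<in> W \<union> C" "q \<in> W \<union> C" using cW by (auto simp: keys_add_nat keys_a)
        then show "p \<in> C" using e ind[of p q] WCE[of p q] by blast
      qed
      then show False using sq by (simp add: square_exps_def)
    qed
  next
    assume "Poly_Mapping.keys c \<inter> ?A \<noteq> {}"
    then obtain v where v: "v \<in> V" "v \<notin> W" "v \<in> Poly_Mapping.keys c" by blast
    then have pos: "1 \<le> Poly_Mapping.lookup c v" by (simp add: in_keys_iff)
    have "two_edges E (Poly_Mapping.lookup (a + c))"
    proof (cases "v \<in> N")
      case True
      then obtain d where d: "d \<in> C" "{v, d} \<in> E" by (auto simp: N_def)
      show ?thesis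
        by (rule two_edges_triangle_plus[OF E ne d(2) _ edge(3)[OF d(2)]])
          (use d pos in \<open>auto simp: lookup_add a C\<close>)
    next
      case False
      then obtain w where w: "w \<in> W" "{v, w} \<in> E" using dom v by blast
      have "v \<notin> C" "w \<notin> C" using False CN WC w by auto
      then show ?thesis
        using w pos E(1) by (intro two_edgesI[of v w E x y]) (auto simp: lookup_add a C)
    qed
    then show "a + c \<in> square_exps V E" using aV c by (simp add: square_exps_def)
  qed
  then have "associated V (square_exps V E) ?A"
    unfolding associated_def using aV by blast
  moreover have "\<not> associated V (edge_exps V E) ?A"
  proof
    assume "associated V (edge_exps V E) ?A"
    then obtain b where b: "b \<in> exps V"
      and iff: "\<And>c. c \<in> exps V \<Longrightarrow> b + c \<in> edge_exps V E \<longleftrightarrow> Poly_Mapping.keys c \<inter> ?A \<noteq> {}"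
      unfolding associated_def by blast
    have "b \<notin> edge_exps V E" using iff[of 0] by simp
    then have no_edge: "\<not> ({p, q} \<in> E \<and> p \<in> Poly_Mapping.keys b \<and> q \<in> Poly_Mapping.keys b)" for p q
      using b by (auto simp: edge_exps_def)
    have add: "\<exists>p q. {p, q} \<in> E \<and> p \<in> insert v (Poly_Mapping.keys b) \<and> q \<in> insert v (Poly_Mapping.keys b)"
      if "v \<in> ?A" for v
    proof -
      have "b + Poly_Mapping.single v 1 \<in> edge_exps V E"
        using iff[of "Poly_Mapping.single v 1"] that by simp
      then show ?thesis by (auto simp: edge_exps_def keys_add_nat)
    qed
    \<comment> \<open>The corner \<open>x\<close> is adjacent to some \<open>u\<close> in the support of \<open>b\<close>. As \<open>u \<in> N\<close>, multiplying
      by the variable of \<open>u\<close> would have to give an edge, but it leaves the support unchanged.\<close>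
    have "x \<in> N" using CN by (auto simp: C)
    then have "x \<in> ?A" using WV \<open>N \<subseteq> V\<close> by blast
    from add[OF this] obtain p q where pq: "{p, q} \<in> E" "p \<in> insert x (Poly_Mapping.keys b)" "q \<in> insert x (Poly_Mapping.keys b)"
      by blast
    have "p \<noteq> q" by (rule edge(3)[OF pq(1)])
    then have "\<exists>u. {u, x} \<in> E \<and> u \<in> Poly_Mapping.keys b"
      using pq no_edge[of p q] by (auto simp: insert_commute)
    then obtain u where u: "{u, x} \<in> E" "u \<in> Poly_Mapping.keys b" by blast
    then have "u \<in> N" using edge[OF u(1)] by (auto simp: N_def C)
    then have "u \<in> ?A" using WV \<open>N \<subseteq> V\<close> by blast
    from add[OF this] show False using no_edge u(2) by (auto simp: insert_absorb)
  qed
  ultimately show thesis using W(2) v0(1) by (intro that[of ?A]) auto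
qed

lemma meets_inject:
  assumes "A \<subseteq> V" "B \<subseteq> V" shows "meets V A = meets V B \<longleftrightarrow> A = B"
proof
  assume eq: "meets V A = meets V B"
  have mem: "v \<in> D \<longleftrightarrow> v \<in> V \<and> Poly_Mapping.single v 1 \<in> meets V D" if "D \<subseteq> V" for v D
    using that by (auto simp: meets_def)
  have "v \<in> A \<longleftrightarrow> v \<in> B" for v
    unfolding mem[OF assms(1), of v] mem[OF assms(2), of v] eq ..
  then show "A = B" by blast
qed simp

text \<open>
  Distinct sets of variables generate distinct primes, so the inclusion can be read off from the
  sets of variables.
\<close>

lemma Ass_square_subset_iff:
  fixes V :: "'v::linorder set"
  assumes G: "simple_graph V E"
  shows "Ass_quot (poly_ring V) (polys_on (square_exps V E) :: (_ \<Rightarrow>\<^sub>0 'k::field) set)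
      \<subseteq> Ass_quot (poly_ring V) (polys_on (edge_exps V E)) \<union> {polys_on (meets V V)}
    \<longleftrightarrow> (\<forall>C. three_cycle E C \<longrightarrow> central V E C)" (is "?L \<longleftrightarrow> _")
proof -
  have Ass: "P \<in> Ass_quot (poly_ring V) (polys_on M) \<longleftrightarrow>
      (\<exists>A\<subseteq>V. P = polys_on (meets V A) \<and> associated V M A)"
    if "monomial_set V M" for P :: "(_ \<Rightarrow>\<^sub>0 'k) set" and M
    unfolding associated_def by (rule Ass_quot_polys_on[OF that])
  have in_rhs: "P \<in> Ass_quot (poly_ring V) (polys_on (edge_exps V E)) \<union> {polys_on (meets V V)}
      \<longleftrightarrow> A = V \<or> associated V (edge_exps V E) A"
    if "A \<subseteq> V" "P = polys_on (meets V A)" for A and P :: "(_ \<Rightarrow>\<^sub>0 'k) set"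
    using that by (auto simp: Ass[OF monomial_set_edge_exps] polys_on_inject meets_inject)
  have "?L \<longleftrightarrow> (\<forall>A\<subseteq>V. associated V (square_exps V E) A \<longrightarrow> A = V \<or> associated V (edge_exps V E) A)"
    (is "_ \<longleftrightarrow> ?A")
  proof
    assume L: ?L
    show ?A
    proof (intro allI impI)
      fix A assume A: "A \<subseteq> V" "associated V (square_exps V E) A"
      then have "(polys_on (meets V A) :: (_ \<Rightarrow>\<^sub>0 'k) set) \<in> Ass_quot (poly_ring V) (polys_on (square_exps V E))"
        by (subst Ass[OF monomial_set_square_exps]) blast
      with L have "(polys_on (meets V A) :: (_ \<Rightarrow>\<^sub>0 'k) set)
          \<in> Ass_quot (poly_ring V) (polys_on (edge_exps V E)) \<union> {polys_on (meets V V)}"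
        by (rule subsetD)
      then show "A = V \<or> associated V (edge_exps V E) A" using in_rhs[OF A(1) refl] by (rule iffD1[rotated])
    qed
  next
    assume A: ?A
    show ?L
    proof
      fix P :: "(_ \<Rightarrow>\<^sub>0 'k) set" assume "P \<in> Ass_quot (poly_ring V) (polys_on (square_exps V E))"
      then obtain A where "A \<subseteq> V" "P = polys_on (meets V A)" "associated V (square_exps V E) A"
        unfolding Ass[OF monomial_set_square_exps] by blast
      with A in_rhs[of A P] show "P \<in> Ass_quot (poly_ring V) (polys_on (edge_exps V E)) \<union> {polys_on (meets V V)}"
        by (intro iffD2[OF in_rhs]) auto
    qed
  qed
  also have "\<dots> \<longleftrightarrow> (\<forall>C. three_cycle E C \<longrightarrow> central V E C)" (is "?A \<longleftrightarrow> ?C")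
  proof
    assume A: ?A
    show ?C
    proof (intro allI impI, rule ccontr)
      fix C assume "three_cycle E C" "\<not> central V E C"
      then obtain A where "A \<subseteq> V" "A \<noteq> V" "associated V (square_exps V E) A" "\<not> associated V (edge_exps V E) A"
        by (rule noncentral_associated[OF G])
      with A show False by blast
    qed
  next
    assume ?C
    then show ?A using associated_square_exps_central[OF G] by blast
  qed
  finally show ?thesis .
qed

theorem theorem2p12:
  fixes n :: nat and E :: "nat set set"
    and S :: "((nat \<Rightarrow>\<^sub>0 nat) \<Rightarrow>\<^sub>0 'k::field) ring"
    and I \<mm> :: "((nat \<Rightarrow>\<^sub>0 nat) \<Rightarrow>\<^sub>0 'k) set"
  assumes "simple_graph {1..n} E"
    and "no_isolated_vertices {1..n} E"
    and "S = poly_ring {1..n}"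
    and "I = edge_ideal {1..n} E"
    and "\<mm> = Idl\<^bsub>S\<^esub> (Var ` {1..n})"
  shows "(intersection_type {1..n} (ideal_power S I 2)
            \<longleftrightarrow> Ass_quot S (ideal_power S I 2) \<subseteq> Ass_quot S I \<union> {\<mm>})
       \<and> (Ass_quot S (ideal_power S I 2) \<subseteq> Ass_quot S I \<union> {\<mm>}
            \<longleftrightarrow> (\<forall>C. three_cycle E C \<longrightarrow> central {1..n} E C))"
proof -
  note G = assms(1)
  have m: "\<mm> = polys_on (meets {1..n} {1..n})"
    unfolding assms by (rule genideal_Var) simp
  have I: "I = polys_on (edge_exps {1..n} E)"
    unfolding assms by (rule edge_ideal_eq[OF G])
  have I2: "ideal_power S I 2 = polys_on (square_exps {1..n} E)"
    unfolding assms by (rule edge_ideal_square[OF G])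
  have "intersection_type {1..n} (ideal_power S I 2) \<longleftrightarrow> (\<forall>C. three_cycle E C \<longrightarrow> central {1..n} E C)"
    unfolding I2 intersection_type_polys_on[OF finite_atLeastAtMost]
    by (rule intersection_type_square_exps_iff[OF G assms(2)])
  moreover have "Ass_quot S (ideal_power S I 2) \<subseteq> Ass_quot S I \<union> {\<mm>}
      \<longleftrightarrow> (\<forall>C. three_cycle E C \<longrightarrow> central {1..n} E C)"
    unfolding I2 unfolding I m assms(3) by (rule Ass_square_subset_iff[OF G])
  ultimately show ?thesis by blast
qed

end
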